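(* Let $d\in\{2,3,\dots\}\cup\{\infty\}$, and let $(\mathbf b=(b_j)_{j=1}^d,\mathbf n=(n_j)_{j=1}^d)$ be a pair of weight and frequency data of length $d$ such that $\{\ln n_j: j=1,\dots,d\}$ is linearly dependent over $\mathbb Q$. Then the multiplier variety $V$ associated with $K_{\mathbf b,\mathbf n}$ is given by $$V=\mathbb B_d\cap\bigcap_{J\in\mathcal J(\mathbf n)}Z(q_J),$$ where for each $J\in\mathcal J(\mathbf n)$ the polynomial $$q_J(\mathbf z)=\prod_{i\in J_1}b_i^{\beta_i/2}\prod_{i\in J_2}z_i^{\beta_i}-\prod_{i\in J_2}b_i^{\beta_i/2}\prod_{i\in J_1}z_i^{\beta_i},\qquad \mathbf z=(z_i)_{i=1}^d\in\mathbb C^d,$$ is determined by the unique partition $\{J_1,J_2\}$ of $J$ and the unique tuple $(\beta_j)_{j\in J}$ of positive integers with $\gcd(\beta_j)_{j\in J}=1$ satisfying $\prod_{i\in J_1}n_i^{\beta_i}=\prod_{i\in J_2}n_i^{\beta_i}$, and $Z(q_J)$ denotes the zero set of $q_J$.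
   Context: Conventions: $\mathbb N=\{1,2,\dots\}$ and $\mathbb N_{\ge2}=\{2,3,\dots\}$. For $d=\infty$ the index set $\{1,\dots,d\}$ means $\mathbb N$ and $\mathbb C^d$ means the Hilbert space of square-summable sequences. $\mathbb B_d$ is the open unit ball of $\mathbb C^d$, and $\mathbb H_\rho=\{s\in\mathbb C:\operatorname{Re}(s)>\rho\}$. A pair $(\mathbf b,\mathbf n)$ of weight and frequency data of length $d$ consists of a $d$-tuple $\mathbf b=(b_j)_{j=1}^d$ of positive reals and a $d$-tuple $\mathbf n=(n_j)_{j=1}^d$ of distinct elements of $\mathbb N_{\ge2}$; if $d=\infty$ it is always assumed that $\sigma_a(\sum_j b_jn_j^{-s})<\infty$, where $\sigma_a$ is the abscissa of absolute convergence of a Dirichlet series. Choose $\rho\in\mathbb R$ such that $\sum_j b_jn_j^{-2\operatorname{Re}(s)}<1$ for all $s\in\mathbb H_\rho$. The associated kernel is $K_{\mathbf b,\mathbf n}(s,u)=\dfrac1{1-\sum_{j=1}^d b_jn_j^{-s-\overline u}}$ on $\mathbb H_\rho\times\mathbb H_\rho$, and $f_{\mathbf b,\mathbf n}:\mathbb H_\rho\to\mathbb B_d$ is $f_{\mathbf b,\mathbf n}(s)=(\sqrt{b_j}\,n_j^{-s})_{j=1}^d$. $\mathcal M_d$ is the multiplier algebra of the Drury–Arveson space $H^2_d$, the reproducing kernel Hilbert space on $\mathbb B_d$ with kernel $1/(1-\langle \mathbf z,\mathbf w\rangle)$. The (smallest) multiplier variety associated with $K_{\mathbf b,\mathbf n}$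 is $$V=\{\mathbf z\in\mathbb B_d: g(\mathbf z)=0\text{ for all } g\in\mathcal M_d\text{ with } g|_{f_{\mathbf b,\mathbf n}(\mathbb H_\rho)}\equiv0\}.$$ $\mathcal J(\mathbf n)$ is the collection of all $J\subseteq\{1,\dots,d\}$ such that $\{\ln n_j:j\in J\}$ is linearly dependent over $\mathbb Q$ and $\{\ln n_j: j\in J'\}$ is linearly independent over $\mathbb Q$ for every proper subset $J'\subsetneq J$; every such $J$ is finite. For each $J\in\mathcal J(\mathbf n)$ there are a unique (unordered) partition $\{J_1,J_2\}$ of $J$ and a unique tuple $(\beta_j)_{j\in J}\in\mathbb N^{|J|}$ with $\gcd(\beta_j)_{j\in J}=1$ such that $\prod_{i\in J_1}n_i^{\beta_i}=\prod_{i\in J_2}n_i^{\beta_i}$. Exchanging $J_1$ and $J_2$ changes $q_J$ only by a sign. *)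

theory Defs
  imports "HOL-Analysis.Analysis"
begin

section \<open>The Hilbert space of square-summable \<open>d\<close>-tuples, for \<open>d\<close> finite or infinite\<close>

definition idx :: "enat \<Rightarrow> nat set" where
  "idx d = {j. 1 \<le> j \<and> enat j \<le> d}"

text \<open>A vector is a function on \<open>nat\<close> that is zero outside the index set; for finite \<open>d\<close> the
  summability condition is void.\<close>

definition Cd :: "enat \<Rightarrow> (nat \<Rightarrow> complex) set" where
  "Cd d = {z. (\<forall>j. j \<notin> idx d \<longrightarrow> z j = 0) \<and> (\<lambda>j. (cmod (z j))\<^sup>2) summable_on idx d}"

definition Cd_inner :: "enat \<Rightarrow> (nat \<Rightarrow> complex) \<Rightarrow> (nat \<Rightarrow> complex) \<Rightarrow> complex" where
  "Cd_inner d z w = (\<Sum>\<^sub>\<infinity>j\<in>idx d. z j * cnj (w j))"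

definition Cd_ball :: "enat \<Rightarrow> (nat \<Rightarrow> complex) set" where
  "Cd_ball d = {z \<in> Cd d. (\<Sum>\<^sub>\<infinity>j\<in>idx d. (cmod (z j))\<^sup>2) < 1}"


section \<open>Reproducing kernel Hilbert spaces and their multipliers\<close>

text \<open>Functions on a set \<open>X\<close> are represented by total functions that are zero outside \<open>X\<close>, so
  that equality of functions on \<open>X\<close> is equality in HOL.\<close>

definition functions_on :: "'a set \<Rightarrow> ('a \<Rightarrow> complex) set" where
  "functions_on X = {f. \<forall>x. x \<notin> X \<longrightarrow> f x = 0}"

definition kernel_fun :: "'a set \<Rightarrow> ('a \<Rightarrow> 'a \<Rightarrow> complex) \<Rightarrow> 'a \<Rightarrow> 'a \<Rightarrow> complex" where
  "kernel_fun X k y = (\<lambda>x. if x \<in> X then k x y else 0)"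

text \<open>\<open>H\<close> is a complex Hilbert space of functions on \<open>X\<close> under pointwise operations, with inner
  product \<open>ip\<close> (linear in the first argument) and reproducing kernel \<open>k\<close>. The kernel determines
  \<open>H\<close>, and \<open>ip\<close> on \<open>H\<close>, uniquely.\<close>

locale rkhs =
  fixes X :: "'a set"
    and k :: "'a \<Rightarrow> 'a \<Rightarrow> complex"
    and H :: "('a \<Rightarrow> complex) set"
    and ip :: "('a \<Rightarrow> complex) \<Rightarrow> ('a \<Rightarrow> complex) \<Rightarrow> complex"
  assumes functions_on_X: "H \<subseteq> functions_on X"
    and zero_mem: "(\<lambda>x. 0) \<in> H"
    and add_mem: "\<And>f g. f \<in> H \<Longrightarrow> g \<in> H \<Longrightarrow> (\<lambda>x. f x + g x) \<in> H"
    and scale_mem: "\<And>c f. f \<in> H \<Longrightarrow> (\<lambda>x. c * f x) \<in> H"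
    and ip_cnj: "\<And>f g. f \<in> H \<Longrightarrow> g \<in> H \<Longrightarrow> ip g f = cnj (ip f g)"
    and ip_add: "\<And>f g h. f \<in> H \<Longrightarrow> g \<in> H \<Longrightarrow> h \<in> H \<Longrightarrow> ip (\<lambda>x. f x + g x) h = ip f h + ip g h"
    and ip_scale: "\<And>c f g. f \<in> H \<Longrightarrow> g \<in> H \<Longrightarrow> ip (\<lambda>x. c * f x) g = c * ip f g"
    and ip_nonneg: "\<And>f. f \<in> H \<Longrightarrow> 0 \<le> Re (ip f f)"
    and ip_definite: "\<And>f. f \<in> H \<Longrightarrow> ip f f = 0 \<Longrightarrow> f = (\<lambda>x. 0)"
    and complete: "\<And>F :: nat \<Rightarrow> 'a \<Rightarrow> complex.
      (\<And>i. F i \<in> H) \<Longrightarrow>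
      (\<And>e. e > 0 \<Longrightarrow> \<exists>N. \<forall>m\<ge>N. \<forall>l\<ge>N.
         sqrt (Re (ip (\<lambda>x. F m x - F l x) (\<lambda>x. F m x - F l x))) < e) \<Longrightarrow>
      \<exists>f\<in>H. (\<lambda>i. sqrt (Re (ip (\<lambda>x. F i x - f x) (\<lambda>x. F i x - f x)))) \<longlonglongrightarrow> 0"
    and kernel_mem: "\<And>y. y \<in> X \<Longrightarrow> kernel_fun X k y \<in> H"
    and reproducing: "\<And>f y. f \<in> H \<Longrightarrow> y \<in> X \<Longrightarrow> ip f (kernel_fun X k y) = f y"

definition multiplier_algebra :: "'a set \<Rightarrow> ('a \<Rightarrow> complex) set \<Rightarrow> ('a \<Rightarrow> complex) set" where
  "multiplier_algebra X H = {g \<in> functions_on X. \<forall>f\<in>H. (\<lambda>x. g x * f x) \<in> H}"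

definition drury_arveson_kernel :: "enat \<Rightarrow> (nat \<Rightarrow> complex) \<Rightarrow> (nat \<Rightarrow> complex) \<Rightarrow> complex" where
  "drury_arveson_kernel d z w = 1 / (1 - Cd_inner d z w)"

abbreviation is_drury_arveson_space ::
  "enat \<Rightarrow> ((nat \<Rightarrow> complex) \<Rightarrow> complex) set \<Rightarrow>
    (((nat \<Rightarrow> complex) \<Rightarrow> complex) \<Rightarrow> ((nat \<Rightarrow> complex) \<Rightarrow> complex) \<Rightarrow> complex) \<Rightarrow> bool" where
  "is_drury_arveson_space d H ip \<equiv> rkhs (Cd_ball d) (drury_arveson_kernel d) H ip"


section \<open>Weight and frequency data\<close>

definition abs_conv_abscissa :: "nat set \<Rightarrow> (nat \<Rightarrow> complex) \<Rightarrow> (nat \<Rightarrow> nat) \<Rightarrow> ereal" where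
  "abs_conv_abscissa I a n =
    (INF s\<in>{s::complex. (\<lambda>j. norm (a j * of_nat (n j) powr (- s))) summable_on I}. ereal (Re s))"

definition weight_frequency_data :: "enat \<Rightarrow> (nat \<Rightarrow> real) \<Rightarrow> (nat \<Rightarrow> nat) \<Rightarrow> bool" where
  "weight_frequency_data d b n \<longleftrightarrow>
    (\<forall>j\<in>idx d. b j > 0) \<and> (\<forall>j\<in>idx d. n j \<ge> 2) \<and> inj_on n (idx d) \<and>
    (d = \<infinity> \<longrightarrow> abs_conv_abscissa (idx d) (\<lambda>j. of_real (b j)) n < \<infinity>)"

definition half_plane :: "real \<Rightarrow> complex set" where
  "half_plane \<rho> = {s. Re s > \<rho>}"

text \<open>Summability is required explicitly because \<open>infsum\<close> is 0 for divergent sums.\<close>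

definition admissible :: "enat \<Rightarrow> (nat \<Rightarrow> real) \<Rightarrow> (nat \<Rightarrow> nat) \<Rightarrow> real \<Rightarrow> bool" where
  "admissible d b n \<rho> \<longleftrightarrow>
    (\<forall>s\<in>half_plane \<rho>.
      (\<lambda>j. b j * real (n j) powr (- 2 * Re s)) summable_on idx d \<and>
      (\<Sum>\<^sub>\<infinity>j\<in>idx d. b j * real (n j) powr (- 2 * Re s)) < 1)"

definition dirichlet_kernel ::
  "enat \<Rightarrow> (nat \<Rightarrow> real) \<Rightarrow> (nat \<Rightarrow> nat) \<Rightarrow> complex \<Rightarrow> complex \<Rightarrow> complex" where
  "dirichlet_kernel d b n s u =
    1 / (1 - (\<Sum>\<^sub>\<infinity>j\<in>idx d. of_real (b j) * of_nat (n j) powr (- s - cnj u)))"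

definition dirichlet_map ::
  "enat \<Rightarrow> (nat \<Rightarrow> real) \<Rightarrow> (nat \<Rightarrow> nat) \<Rightarrow> complex \<Rightarrow> nat \<Rightarrow> complex" where
  "dirichlet_map d b n s =
    (\<lambda>j. if j \<in> idx d then of_real (sqrt (b j)) * of_nat (n j) powr (- s) else 0)"

text \<open>The variety depends on the kernel only through the map that pulls the Drury--Arveson kernel
  back to it.\<close>

lemma dirichlet_kernel_eq:
  assumes "weight_frequency_data d b n"
  shows "dirichlet_kernel d b n s u =
    drury_arveson_kernel d (dirichlet_map d b n s) (dirichlet_map d b n u)"
proof -
  have "of_real (b j) * of_nat (n j) powr (- s - cnj u) =
      dirichlet_map d b n s j * cnj (dirichlet_map d b n u j)" if j: "j \<in> idx d" for j
  proof -
    have b: "b j > 0" and n: "n j \<ge> 2"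
      using assms j by (auto simp: weight_frequency_data_def)
    have "cnj (of_nat (n j) powr (- u)) = of_nat (n j) powr (- cnj u)"
      using n by (subst cnj_powr) auto
    moreover have "of_real (b j) = of_real (sqrt (b j)) * (of_real (sqrt (b j)) :: complex)"
      using b by (simp flip: of_real_mult)
    ultimately show ?thesis
      using j by (simp add: dirichlet_map_def powr_diff powr_minus field_simps)
  qed
  hence "(\<Sum>\<^sub>\<infinity>j\<in>idx d. of_real (b j) * of_nat (n j) powr (- s - cnj u)) =
      Cd_inner d (dirichlet_map d b n s) (dirichlet_map d b n u)"
    unfolding Cd_inner_def by (intro infsum_cong)
  thus ?thesis
    by (simp add: dirichlet_kernel_def drury_arveson_kernel_def)
qed

text \<open>Here \<open>H\<close> is the Drury--Arveson space.\<close>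

definition multiplier_variety ::
  "enat \<Rightarrow> ((nat \<Rightarrow> complex) \<Rightarrow> complex) set \<Rightarrow> (nat \<Rightarrow> real) \<Rightarrow> (nat \<Rightarrow> nat) \<Rightarrow> real \<Rightarrow>
    (nat \<Rightarrow> complex) set" where
  "multiplier_variety d H b n \<rho> =
    {z \<in> Cd_ball d. \<forall>g\<in>multiplier_algebra (Cd_ball d) H.
      (\<forall>w\<in>dirichlet_map d b n ` half_plane \<rho>. g w = 0) \<longrightarrow> g z = 0}"


section \<open>Minimal multiplicative relations between the frequencies\<close>

definition log_dependent :: "(nat \<Rightarrow> nat) \<Rightarrow> nat set \<Rightarrow> bool" where
  "log_dependent n J \<longleftrightarrow>
    module.dependent (\<lambda>(q::rat) (x::real). of_rat q * x) ((\<lambda>j. ln (real (n j))) ` J)"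

definition minimal_dependent :: "enat \<Rightarrow> (nat \<Rightarrow> nat) \<Rightarrow> nat set set" where
  "minimal_dependent d n =
    {J. J \<subseteq> idx d \<and> log_dependent n J \<and> (\<forall>J'. J' \<subset> J \<longrightarrow> \<not> log_dependent n J')}"

definition relation_data ::
  "(nat \<Rightarrow> nat) \<Rightarrow> nat set \<Rightarrow> nat set \<times> nat set \<times> (nat \<Rightarrow> nat) \<Rightarrow> bool" where
  "relation_data n J = (\<lambda>(J1, J2, \<beta>).
    J1 \<union> J2 = J \<and> J1 \<inter> J2 = {} \<and> J1 \<noteq> {} \<and> J2 \<noteq> {} \<and>
    (\<forall>j\<in>J. \<beta> j \<ge> 1) \<and> Gcd (\<beta> ` J) = 1 \<and>
    (\<Prod>i\<in>J1. n i ^ \<beta> i) = (\<Prod>i\<in>J2. n i ^ \<beta> i))"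

text \<open>For minimal dependent \<open>J\<close> the relation data exist and are unique up to exchanging \<open>J1\<close> and
  \<open>J2\<close> (and up to the values of \<open>\<beta>\<close> outside \<open>J\<close>). The choice made here affects only the sign of
  the polynomial.\<close>

definition q_poly :: "(nat \<Rightarrow> real) \<Rightarrow> (nat \<Rightarrow> nat) \<Rightarrow> nat set \<Rightarrow> (nat \<Rightarrow> complex) \<Rightarrow> complex" where
  "q_poly b n J z = (case SOME r. relation_data n J r of (J1, J2, \<beta>) \<Rightarrow>
    of_real (\<Prod>i\<in>J1. b i powr (real (\<beta> i) / 2)) * (\<Prod>i\<in>J2. z i ^ \<beta> i) -
    of_real (\<Prod>i\<in>J2. b i powr (real (\<beta> i) / 2)) * (\<Prod>i\<in>J1. z i ^ \<beta> i))"

definition zero_set :: "enat \<Rightarrow> ((nat \<Rightarrow> complex) \<Rightarrow> complex) \<Rightarrow> (nat \<Rightarrow> complex) set" where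
  "zero_set d q = {z \<in> Cd d. q z = 0}"

end

theory Submission
  imports Defs
begin

text \<open>Expanding \<open>1 / (1 - \<langle>z, w\<rangle>)\<close> over words (finite sequences of indices) gives
  \<open>\<Sum>l. z\<^sup>l cnj (w\<^sup>l)\<close>, so \<open>H\<close> consists of the functions \<open>\<Sum>l. a l * z\<^sup>l\<close> with
  square-summable \<open>a\<close>; in particular the coordinates are multipliers, and so are the \<open>q\<^sub>J\<close>, which
  vanish on the image of the Dirichlet map. Conversely, composing a multiplier with the Dirichlet map
  gives a Dirichlet series whose coefficient at \<open>N\<close> collects the words \<open>l\<close> with \<open>n\<^sup>l = N\<close>. If it
  vanishes, all these partial sums vanish. At a common zero \<open>z\<close> of the \<open>q\<^sub>J\<close> the normalized monomial
  \<open>\<Prod>j\<in>l. z\<^sub>j / sqrt b\<^sub>j\<close> depends only on \<open>n\<^sup>l\<close>, so the expansion of the multiplier at \<open>z\<close>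
  vanishes group by group. Indexing by words rather than multi-indices avoids multinomial
  coefficients.\<close>

section \<open>Riesz representation in a reproducing kernel Hilbert space\<close>

text \<open>The space \<open>H\<close> is given only through its reproducing property, so its
  description by word series has to be derived: Riesz representation puts every square-summable
  series into \<open>H\<close>, and the norm bound obtained with it yields the expansion of every
  member. That bound cannot be an equality, because permuted words give the same monomial. Two
  obstacles shape the passage to a common zero \<open>z\<close> of the \<open>q_J\<close>. The
  minimal relations need not generate the lattice of all relations, and coordinates of
  \<open>z\<close> may vanish, so that monomials cannot be divided. Hence nonvanishing coordinates
  are treated by Laurent monomials and powers with coprime exponents, and vanishing ones by a
  separate sign argument: if two words have equal value and the coordinate of a letter occurring
  more often in one of them vanishes, both monomials are zero. Regrouping words by their value is
  legitimate because all sums are unordered, hence absolutely convergent.\<close>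

lemma (in rkhs) diff_mem:
  assumes "f \<in> H" "g \<in> H"
  shows "(\<lambda>x. f x - g x) \<in> H"
  using add_mem[OF assms(1) scale_mem[OF assms(2), of "-1"]] by simp

lemma (in rkhs) sum_mem:
  assumes "\<And>i. i \<in> A \<Longrightarrow> f i \<in> H"
  shows "(\<lambda>x. \<Sum>i\<in>A. f i x) \<in> H"
  using assms by (induction A rule: infinite_finite_induct) (auto intro: zero_mem add_mem)

lemma (in rkhs) ip_zero:
  assumes "f \<in> H"
  shows "ip (\<lambda>x. 0) f = 0" "ip f (\<lambda>x. 0) = 0"
proof -
  show "ip (\<lambda>x. 0) f = 0"
    using ip_scale[OF zero_mem assms, of 0] by simp
  thus "ip f (\<lambda>x. 0) = 0"
    using ip_cnj[OF zero_mem assms] by simp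
qed

lemma (in rkhs) ip_add_right:
  assumes "f \<in> H" "g \<in> H" "h \<in> H"
  shows "ip h (\<lambda>x. f x + g x) = ip h f + ip h g"
  using assms by (simp add: ip_cnj[OF _ \<open>h \<in> H\<close>] add_mem ip_add)

lemma (in rkhs) ip_scale_right:
  assumes "f \<in> H" "h \<in> H"
  shows "ip h (\<lambda>x. c * f x) = cnj c * ip h f"
  using assms by (simp add: ip_cnj[OF _ \<open>h \<in> H\<close>] scale_mem ip_scale)

lemma (in rkhs) ip_diff_right:
  assumes "f \<in> H" "g \<in> H" "h \<in> H"
  shows "ip h (\<lambda>x. f x - g x) = ip h f - ip h g"
  using ip_add_right[OF assms(1) scale_mem[OF assms(2), of "-1"] assms(3)]
    ip_scale_right[OF assms(2,3), of "-1"] by simp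

lemma (in rkhs) ip_sum:
  assumes "\<And>i. i \<in> A \<Longrightarrow> f i \<in> H" "h \<in> H"
  shows "ip (\<lambda>x. \<Sum>i\<in>A. c i * f i x) h = (\<Sum>i\<in>A. c i * ip (f i) h)"
  using assms(1)
  by (induction A rule: infinite_finite_induct)
    (auto simp: ip_zero assms(2) ip_add scale_mem sum_mem ip_scale)

lemma (in rkhs) ip_sum_right:
  assumes "\<And>i. i \<in> A \<Longrightarrow> f i \<in> H" "h \<in> H"
  shows "ip h (\<lambda>x. \<Sum>i\<in>A. c i * f i x) = (\<Sum>i\<in>A. cnj (c i) * ip h (f i))"
proof -
  have "ip h (\<lambda>x. \<Sum>i\<in>A. c i * f i x) = cnj (ip (\<lambda>x. \<Sum>i\<in>A. c i * f i x) h)"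
    by (rule ip_cnj) (use assms in \<open>auto intro!: sum_mem scale_mem\<close>)
  also have "\<dots> = (\<Sum>i\<in>A. cnj (c i) * cnj (ip (f i) h))"
    using assms by (simp add: ip_sum)
  also have "\<dots> = (\<Sum>i\<in>A. cnj (c i) * ip h (f i))"
    using assms by (intro sum.cong) (auto simp: ip_cnj[of _ h])
  finally show ?thesis .
qed

section \<open>Norm and Cauchy-Schwarz inequality\<close>

definition (in rkhs) norm_sq :: "('a \<Rightarrow> complex) \<Rightarrow> real" where
  "norm_sq f = Re (ip f f)"

lemma (in rkhs) norm_sq_nonneg: "f \<in> H \<Longrightarrow> 0 \<le> norm_sq f"
  by (simp add: norm_sq_def ip_nonneg)

lemma (in rkhs) ip_self: "f \<in> H \<Longrightarrow> ip f f = of_real (norm_sq f)"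
  using ip_cnj[of f f] by (auto simp: norm_sq_def complex_eq_iff)

text \<open>Scaling, differences, Cauchy-Schwarz and the variation in the Riesz lemma all specialize
  this expansion, hence the complex factor \<open>c\<close>.\<close>

lemma (in rkhs) norm_sq_add_scale:
  assumes "f \<in> H" "g \<in> H"
  shows "norm_sq (\<lambda>x. f x + c * g x) =
    norm_sq f + 2 * Re (cnj c * ip f g) + (cmod c)\<^sup>2 * norm_sq g"
proof -
  have m: "(\<lambda>x. c * g x) \<in> H" using assms scale_mem by blast
  have "ip (\<lambda>x. f x + c * g x) (\<lambda>x. f x + c * g x) =
      ip f f + cnj c * ip f g + (c * cnj (ip f g) + c * (cnj c * ip g g))"
    using assms m by (simp add: ip_add ip_add_right add_mem ip_scale ip_scale_right
        ip_cnj[of f g] algebra_simps)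
  also have "c * cnj (ip f g) = cnj (cnj c * ip f g)"
    by simp
  also have "c * (cnj c * ip g g) = of_real ((cmod c)\<^sup>2 * norm_sq g)"
    using assms by (simp add: ip_self mult.assoc[symmetric] complex_norm_square[symmetric])
  finally have "ip (\<lambda>x. f x + c * g x) (\<lambda>x. f x + c * g x) =
      ip f f + cnj c * ip f g + (cnj (cnj c * ip f g) + of_real ((cmod c)\<^sup>2 * norm_sq g))" .
  from arg_cong[OF this, of Re] show ?thesis
    unfolding norm_sq_def[of "\<lambda>x. f x + c * g x"] norm_sq_def[of f]
    by (simp del: complex_cnj_mult)
qed

lemma (in rkhs) norm_sq_scale:
  assumes "f \<in> H"
  shows "norm_sq (\<lambda>x. c * f x) = (cmod c)\<^sup>2 * norm_sq f"
  using norm_sq_add_scale[OF zero_mem assms, of c]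
  by (simp add: ip_zero assms) (simp add: norm_sq_def ip_zero zero_mem)

lemma (in rkhs) norm_sq_diff:
  assumes "f \<in> H" "g \<in> H"
  shows "norm_sq (\<lambda>x. f x - g x) = norm_sq f - 2 * Re (ip f g) + norm_sq g"
  using norm_sq_add_scale[OF assms, of "-1"] by simp

lemma (in rkhs) cauchy_schwarz:
  assumes "f \<in> H" "g \<in> H"
  shows "(cmod (ip f g))\<^sup>2 \<le> norm_sq f * norm_sq g"
proof (cases "norm_sq g = 0")
  case True
  hence "g = (\<lambda>x. 0)"
    using ip_self[OF assms(2)] ip_definite[OF assms(2)] by simp
  thus ?thesis using ip_zero[OF assms(1)] True by simp
next
  case False
  hence pos: "norm_sq g > 0" using norm_sq_nonneg[OF assms(2)] by simp
  \<comment> \<open>With this factor \<open>f + c g\<close> is the component of \<open>f\<close>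
    orthogonal to \<open>g\<close>.\<close>
  define c where "c = - (ip f g / of_real (norm_sq g))"
  define m where "m = (cmod (ip f g))\<^sup>2"
  have "cnj c * ip f g = - of_real (m / norm_sq g)"
    by (simp add: c_def m_def complex_norm_square mult.commute del: of_real_power)
  moreover have "(cmod c)\<^sup>2 * norm_sq g = m / norm_sq g"
    using pos by (simp add: c_def m_def norm_divide power_divide power2_eq_square)
  ultimately have "norm_sq (\<lambda>x. f x + c * g x) = norm_sq f - m / norm_sq g"
    using norm_sq_add_scale[OF assms, of c] by simp
  moreover have "0 \<le> norm_sq (\<lambda>x. f x + c * g x)"
    using assms by (intro norm_sq_nonneg add_mem scale_mem)
  ultimately have "m / norm_sq g \<le> norm_sq f" by simp
  thus ?thesis using pos by (simp add: m_def field_simps)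
qed

lemma (in rkhs) norm_ip_le:
  assumes "f \<in> H" "g \<in> H"
  shows "cmod (ip f g) \<le> sqrt (norm_sq f) * sqrt (norm_sq g)"
  using cauchy_schwarz[OF assms] by (metis real_le_rsqrt real_sqrt_mult)

text \<open>The vector is the limit of a minimizing sequence of \<open>\<parallel>u\<parallel>\<^sup>2 - 2 Re p\<close>, which is Cauchy
  by the parallelogram law. Working with the graph \<open>R\<close> of the functional makes it unnecessary to
  know in advance that \<open>p\<close> is a function of \<open>u\<close>.\<close>

lemma (in rkhs) riesz_representation:
  fixes R :: "(('a \<Rightarrow> complex) \<times> complex) set"
  assumes mem: "\<And>u p. (u, p) \<in> R \<Longrightarrow> u \<in> H"
    and nonempty: "R \<noteq> {}"
    and add: "\<And>u p v q. (u, p) \<in> R \<Longrightarrow> (v, q) \<in> R \<Longrightarrow> (\<lambda>x. u x + v x, p + q) \<in> R"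
    and scale: "\<And>u p c. (u, p) \<in> R \<Longrightarrow> (\<lambda>x. c * u x, c * p) \<in> R"
    and bound: "\<And>u p. (u, p) \<in> R \<Longrightarrow> 2 * Re p - norm_sq u \<le> B"
  shows "\<exists>v\<in>H. (\<forall>(u, p)\<in>R. ip u v = p) \<and> norm_sq v \<le> B"
proof -
  define J where "J = (\<lambda>(u, p). norm_sq u - 2 * Re p)"
  define m where "m = Inf (J ` R)"
  have bdd: "bdd_below (J ` R)"
    by (rule bdd_belowI[of _ "-B"]) (use bound in \<open>force simp: J_def\<close>)
  have J_ge: "m \<le> J x" if "x \<in> R" for x
    unfolding m_def using that bdd by (intro cInf_lower) auto
  have "\<exists>x\<in>R. J x < m + 1 / real (Suc i)" for i
    using cInf_lessD[of "J ` R" "m + 1 / real (Suc i)"] nonempty by (auto simp: m_def)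
  then obtain S where S: "\<And>i. S i \<in> R" "\<And>i. J (S i) < m + 1 / real (Suc i)"
    by metis
  define F where "F i = fst (S i)" for i
  define P where "P i = snd (S i)" for i
  have FP: "(F i, P i) \<in> R" for i using S(1)[of i] by (simp add: F_def P_def)
  have FH: "F i \<in> H" for i using mem FP by blast
  define eps :: "nat \<Rightarrow> real" where "eps i = 1 / real (Suc i)" for i
  have J_lt: "norm_sq (F i) - 2 * Re (P i) < m + eps i" for i
    using S(2)[of i] by (simp add: J_def F_def eps_def P_def split: prod.splits)
  have close: "norm_sq (\<lambda>x. F i x - F l x) \<le> 2 * (eps i + eps l)" for i l
  proof -
    \<comment> \<open>The midpoint pair lies in \<open>R\<close> again, so the functional is at
      least \<open>m\<close> there; this bounds the norm of the sum from below and hence that of the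
      difference from above.\<close>
    have "(\<lambda>x. (1/2) * (F i x + F l x), (1/2) * (P i + P l)) \<in> R"
      by (intro scale add FP)
    from J_ge[OF this]
    have "m \<le> norm_sq (\<lambda>x. (1/2) * (F i x + F l x)) - 2 * Re ((1/2) * (P i + P l))"
      unfolding J_def by simp
    also have "norm_sq (\<lambda>x. (1/2) * (F i x + F l x)) = norm_sq (\<lambda>x. F i x + F l x) / 4"
      by (subst norm_sq_scale[OF add_mem[OF FH FH]]) (simp add: norm_divide power2_eq_square)
    also have "2 * Re ((1/2) * (P i + P l)) = Re (P i) + Re (P l)"
      by simp
    finally have "m \<le> norm_sq (\<lambda>x. F i x + F l x) / 4 - (Re (P i) + Re (P l))" .
    moreover have "norm_sq (\<lambda>x. F i x + F l x) =
        norm_sq (F i) + 2 * Re (ip (F i) (F l)) + norm_sq (F l)"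
      using norm_sq_add_scale[OF FH FH, of i 1 l] by simp
    moreover note norm_sq_diff[OF FH FH, of i l] J_lt[of i] J_lt[of l]
    ultimately show ?thesis by argo
  qed
  have "\<exists>v\<in>H. (\<lambda>i. sqrt (Re (ip (\<lambda>x. F i x - v x) (\<lambda>x. F i x - v x)))) \<longlonglongrightarrow> 0"
  proof (rule complete[OF FH])
    fix e :: real assume "e > 0"
    then obtain N where N: "4 / e\<^sup>2 < real N"
      using reals_Archimedean2 by blast
    show "\<exists>N. \<forall>k\<ge>N. \<forall>l\<ge>N.
        sqrt (Re (ip (\<lambda>x. F k x - F l x) (\<lambda>x. F k x - F l x))) < e"
    proof (intro exI[of _ N] allI impI)
      fix k l assume kl: "N \<le> k" "N \<le> l"
      have "eps i < e\<^sup>2 / 4" if "N \<le> i" for i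
      proof -
        have "4 / e\<^sup>2 < real (Suc i)" using N that by simp
        thus ?thesis using \<open>e > 0\<close> by (simp add: eps_def field_simps)
      qed
      from this[OF kl(1)] this[OF kl(2)] close[of k l]
      have "norm_sq (\<lambda>x. F k x - F l x) < e\<^sup>2" by argo
      thus "sqrt (Re (ip (\<lambda>x. F k x - F l x) (\<lambda>x. F k x - F l x))) < e"
        using \<open>e > 0\<close> unfolding norm_sq_def by (simp add: real_sqrt_less_iff real_less_lsqrt)
    qed
  qed
  then obtain v where v: "v \<in> H" and lim: "(\<lambda>i. sqrt (norm_sq (\<lambda>x. F i x - v x))) \<longlonglongrightarrow> 0"
    unfolding norm_sq_def by blast
  have DH: "(\<lambda>x. F i x - v x) \<in> H" for i using diff_mem FH v by blast
  have lim_ip: "(\<lambda>i. ip u (F i)) \<longlonglongrightarrow> ip u v" if u: "u \<in> H" for u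
  proof -
    have "(\<lambda>i. ip u (\<lambda>x. F i x - v x)) \<longlonglongrightarrow> 0"
    proof (rule tendsto_norm_zero_cancel, rule tendsto_sandwich[OF _ _ tendsto_const])
      show "\<forall>\<^sub>F i in sequentially. norm (ip u (\<lambda>x. F i x - v x)) \<le>
          sqrt (norm_sq u) * sqrt (norm_sq (\<lambda>x. F i x - v x))"
        by (intro always_eventually allI norm_ip_le u DH)
      show "(\<lambda>i. sqrt (norm_sq u) * sqrt (norm_sq (\<lambda>x. F i x - v x))) \<longlonglongrightarrow> 0"
        using tendsto_mult_right_zero[OF lim] by simp
    qed auto
    thus ?thesis using LIM_zero_cancel by (simp add: ip_diff_right FH v u LIM_zero_iff)
  qed
  have lim_ip': "(\<lambda>i. ip (F i) u) \<longlonglongrightarrow> ip v u" if u: "u \<in> H" for u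
    using tendsto_cnj[OF lim_ip[OF u]] by (simp add: ip_cnj[OF u FH, symmetric] ip_cnj[OF u v, symmetric])
  have lim_norm: "(\<lambda>i. norm_sq (F i)) \<longlonglongrightarrow> norm_sq v"
  proof -
    have "norm_sq (F i) =
        (sqrt (norm_sq (\<lambda>x. F i x - v x)))\<^sup>2 + 2 * Re (ip (F i) v) - norm_sq v" for i
      using norm_sq_diff[OF FH v, of i] norm_sq_nonneg[OF DH, of i] by simp
    moreover have "(\<lambda>i. (sqrt (norm_sq (\<lambda>x. F i x - v x)))\<^sup>2 + 2 * Re (ip (F i) v) - norm_sq v)
        \<longlonglongrightarrow> 0\<^sup>2 + 2 * Re (ip v v) - norm_sq v"
      by (intro tendsto_intros lim lim_ip' v)
    ultimately show ?thesis by (simp add: norm_sq_def)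
  qed
  have repr: "ip u v = p" if up: "(u, p) \<in> R" for u p
  proof -
    have u: "u \<in> H" using mem up by blast
    \<comment> \<open>The defect to be shown zero. Moving the minimizing sequence by
      \<open>t u\<close> cannot push the functional below \<open>m\<close>; in the limit this gives
      a quadratic in \<open>t\<close>, nonnegative for every complex \<open>t\<close>, with linear
      coefficient \<open>e\<close>.\<close>
    define e where "e = ip v u - cnj p"
    have ge: "0 \<le> 2 * Re (cnj t * e) + (cmod t)\<^sup>2 * norm_sq u" for t
    proof -
      have "- (eps i) \<le>
          2 * Re (cnj t * (ip (F i) u - cnj p)) + (cmod t)\<^sup>2 * norm_sq u" for i
      proof -
        have "m \<le> norm_sq (\<lambda>x. F i x + t * u x) - 2 * Re (P i + t * p)"
          using J_ge[OF add[OF FP scale[OF up]], of i t] by (simp add: J_def)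
        moreover have "Re (t * p) = Re (cnj t * cnj p)" by simp
        ultimately show ?thesis
          using J_lt[of i] norm_sq_add_scale[OF FH u, of i t]
          by (simp add: algebra_simps)
      qed
      moreover have "(\<lambda>i. 2 * Re (cnj t * (ip (F i) u - cnj p)) + (cmod t)\<^sup>2 * norm_sq u)
          \<longlonglongrightarrow> 2 * Re (cnj t * e) + (cmod t)\<^sup>2 * norm_sq u"
        unfolding e_def by (intro tendsto_intros lim_ip' u)
      moreover have "(\<lambda>i. - (eps i)) \<longlonglongrightarrow> 0"
        using tendsto_minus[OF LIMSEQ_inverse_real_of_nat] by (simp add: inverse_eq_divide eps_def)
      ultimately show ?thesis by (intro LIMSEQ_le) auto
    qed
    have "e = 0"
    proof (rule ccontr)
      assume "e \<noteq> 0"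
      \<comment> \<open>At \<open>t = - s e\<close> the quadratic equals
        \<open>s |e|^2 (s * norm_sq u - 2)\<close>, which is negative for this \<open>s\<close>; the
        added 1 covers \<open>norm_sq u = 0\<close>.\<close>
      define s where "s = 1 / (norm_sq u + 1)"
      have s: "s > 0" "s * norm_sq u < 2"
        using norm_sq_nonneg[OF u] by (auto simp: s_def field_simps)
      have "Re (cnj (- of_real s * e) * e) = - s * (cmod e)\<^sup>2"
        unfolding cmod_power2 by (simp add: power2_eq_square algebra_simps)
      moreover have "(cmod (- of_real s * e))\<^sup>2 = s * s * (cmod e)\<^sup>2"
        by (simp add: norm_mult power_mult_distrib power2_eq_square)
      ultimately have "0 \<le> s * (cmod e)\<^sup>2 * (s * norm_sq u - 2)"
        using ge[of "- of_real s * e"] by (simp add: algebra_simps)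
      moreover have "s * (cmod e)\<^sup>2 * (s * norm_sq u - 2) < 0"
        using s \<open>e \<noteq> 0\<close> by (intro mult_pos_neg) auto
      ultimately show False by simp
    qed
    thus ?thesis using ip_cnj[OF v u] by (simp add: e_def)
  qed
  \<comment> \<open>Once the functional is known to be pairing with \<open>v\<close>, its value
    along the sequence tends to \<open>- norm_sq v\<close>, so the assumed bound becomes the norm
    bound.\<close>
  have "- B \<le> norm_sq (F i) - 2 * Re (ip (F i) v)" for i
    using bound[OF FP, of i] repr[OF FP, of i] by simp
  moreover have "(\<lambda>i. norm_sq (F i) - 2 * Re (ip (F i) v)) \<longlonglongrightarrow> norm_sq v - 2 * Re (ip v v)"
    by (intro tendsto_intros lim_norm lim_ip' v)
  ultimately have "- B \<le> norm_sq v - 2 * Re (ip v v)"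
    by (intro LIMSEQ_le_const) auto
  hence "norm_sq v \<le> B" by (simp add: norm_sq_def)
  with v repr show ?thesis by blast
qed

section \<open>Monomials indexed by words\<close>

lemma has_sum_sum:
  fixes f :: "'i \<Rightarrow> 'a \<Rightarrow> 'b::topological_comm_monoid_add"
  assumes "\<And>i. i \<in> I \<Longrightarrow> (f i has_sum s i) A"
  shows "((\<lambda>x. \<Sum>i\<in>I. f i x) has_sum (\<Sum>i\<in>I. s i)) A"
  using assms by (induction I rule: infinite_finite_induct) (auto intro: has_sum_add)

text \<open>Polymorphic so that one notion covers the complex monomials, their moduli and the
  integer values of words in the frequencies.\<close>

definition word_prod :: "('i \<Rightarrow> 'a::comm_monoid_mult) \<Rightarrow> 'i list \<Rightarrow> 'a" where
  "word_prod x l = prod_list (map x l)"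

lemma word_prod_Nil [simp]: "word_prod x [] = 1"
  and word_prod_Cons [simp]: "word_prod x (j # l) = x j * word_prod x l"
  by (simp_all add: word_prod_def)

lemma word_prod_mult: "word_prod (\<lambda>j. x j * y j) l = word_prod x l * word_prod y l"
  by (induction l) (simp_all add: ac_simps)

lemma cnj_word_prod: "cnj (word_prod x l) = word_prod (\<lambda>j. cnj (x j)) l"
  by (induction l) simp_all

lemma cmod_word_prod: "cmod (word_prod x l) = word_prod (\<lambda>j. cmod (x j)) l"
  by (induction l) (simp_all add: norm_mult)

lemma word_prod_nonneg: "(\<And>j. 0 \<le> x j) \<Longrightarrow> 0 \<le> word_prod x l" for x :: "'i \<Rightarrow> real"
  by (induction l) simp_all

lemma word_prod_eq_0: "j \<in> set l \<Longrightarrow> x j = 0 \<Longrightarrow> word_prod x l = (0::'a::comm_semiring_1)"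
  by (induction l) auto

text \<open>By commutativity only the letter counts matter; this is the passage from words to
  exponent vectors.\<close>

lemma word_prod_count_list:
  assumes "finite S" "set l \<subseteq> S"
  shows "word_prod x l = (\<Prod>j\<in>S. x j ^ count_list l j)"
  using assms(2)
proof (induction l)
  case (Cons i l)
  have "(\<Prod>j\<in>S. x j ^ count_list (i # l) j) =
      (\<Prod>j\<in>S. (if j = i then x j else 1) * x j ^ count_list l j)"
    by (intro prod.cong) auto
  also have "\<dots> = x i * (\<Prod>j\<in>S. x j ^ count_list l j)"
    using Cons.prems assms(1) by (simp add: prod.distrib)
  finally show ?case using Cons by simp
qed simp

text \<open>Splitting off the first letter replaces a bound \<open>t\<close> by
  \<open>1 + s t\<close>, and \<open>1 / (1 - s)\<close> is the fixed point of that map.\<close>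

lemma sum_word_prod_le:
  fixes x :: "'i \<Rightarrow> real"
  assumes "\<And>j. 0 \<le> x j" "finite A" "sum x A \<le> s" "s < 1"
  shows "(\<Sum>l | set l \<subseteq> A \<and> length l \<le> N. word_prod x l) \<le> 1 / (1 - s)"
proof (induction N)
  case 0
  have "{l. set l \<subseteq> A \<and> length l \<le> 0} = {[]}" by auto
  moreover have "0 \<le> s" using sum_nonneg[of A x] assms by auto
  ultimately show ?case using assms(4) by (simp add: field_simps)
next
  case (Suc N)
  let ?W = "\<lambda>N. {l. set l \<subseteq> A \<and> length l \<le> N}"
  have fin: "finite (?W N)" by (rule finite_lists_length_le[OF assms(2)])
  have eq: "?W (Suc N) = insert [] ((\<lambda>(j, l). j # l) ` (A \<times> ?W N))"
  proof (intro equalityI subsetI)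
    fix l assume "l \<in> ?W (Suc N)"
    thus "l \<in> insert [] ((\<lambda>(j, l). j # l) ` (A \<times> ?W N))"
      by (cases l) auto
  qed auto
  have s0: "0 \<le> s" using sum_nonneg[of A x] assms by auto
  have "(\<Sum>l\<in>?W (Suc N). word_prod x l) = 1 + (\<Sum>(j, l)\<in>A \<times> ?W N. x j * word_prod x l)"
    unfolding eq using fin assms(2)
    by (subst sum.insert) (auto simp: sum.reindex inj_on_def case_prod_unfold)
  also have "(\<Sum>(j, l)\<in>A \<times> ?W N. x j * word_prod x l) = sum x A * (\<Sum>l\<in>?W N. word_prod x l)"
    by (simp add: sum_product sum.cartesian_product)
  also have "\<dots> \<le> s * (1 / (1 - s))"
    using Suc assms s0 by (intro mult_mono sum_nonneg word_prod_nonneg) auto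
  also have "1 + s * (1 / (1 - s)) = 1 / (1 - s)"
    using assms(4) by (simp add: field_simps)
  finally show ?case by simp
qed

text \<open>Any finite set of words uses a finite alphabet and bounded length, so the uniform bound
  for such words applies.\<close>

lemma word_prod_summable:
  fixes x :: "'i \<Rightarrow> real"
  assumes nn: "\<And>j. 0 \<le> x j" and "x summable_on UNIV" and "infsum x UNIV < 1"
  shows "word_prod x summable_on UNIV"
proof (rule nonneg_bdd_above_summable_on)
  show "bdd_above (sum (word_prod x) ` {F. F \<subseteq> UNIV \<and> finite F})"
  proof (rule bdd_aboveI2)
    fix F :: "'i list set" assume "F \<in> {F. F \<subseteq> UNIV \<and> finite F}"
    hence F: "finite F" by simp
    define A where "A = (\<Union>l\<in>F. set l)"
    \<comment> \<open>The inserted 0 keeps \<open>Max\<close> meaningful when \<open>F\<close> is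
      empty.\<close>
    define N where "N = Max (insert 0 (length ` F))"
    have A: "finite A" using F by (simp add: A_def)
    have "sum (word_prod x) F \<le> (\<Sum>l | set l \<subseteq> A \<and> length l \<le> N. word_prod x l)"
      using F A by (intro sum_mono2 finite_lists_length_le word_prod_nonneg nn)
        (auto simp: A_def N_def)
    also have "\<dots> \<le> 1 / (1 - infsum x UNIV)"
      using nn A assms(2,3) by (intro sum_word_prod_le finite_sum_le_infsum) auto
    finally show "sum (word_prod x) F \<le> 1 / (1 - infsum x UNIV)" .
  qed
qed (rule word_prod_nonneg[OF nn])

text \<open>Splitting off the first letter gives \<open>S = 1 + (\<Sum>j. x j) S\<close> for the sum \<open>S\<close> over all
  words.\<close>

lemma word_prod_has_sum:
  fixes x :: "'i \<Rightarrow> complex"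
  assumes summ: "(\<lambda>j. cmod (x j)) summable_on UNIV" and lt: "(\<Sum>\<^sub>\<infinity>j. cmod (x j)) < 1"
  shows "(word_prod x has_sum 1 / (1 - infsum x UNIV)) UNIV"
proof -
  have abs: "(\<lambda>l. cmod (word_prod x l)) summable_on UNIV"
    unfolding cmod_word_prod by (rule word_prod_summable) (use assms in auto)
  hence sm: "word_prod x summable_on UNIV" by (rule abs_summable_summable)
  define S where "S = infsum (word_prod x) UNIV"
  have S: "(word_prod x has_sum S) UNIV" using sm by (simp add: S_def)
  have inj: "inj_on (\<lambda>(j, l). j # l) (UNIV \<times> UNIV)" by (auto simp: inj_on_def)
  have un: "(UNIV :: 'i list set) = insert [] ((\<lambda>(j, l). j # l) ` (UNIV \<times> UNIV))"
  proof -
    have "l \<in> insert [] ((\<lambda>(j, l). j # l) ` (UNIV \<times> UNIV))" for l :: "'i list"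
      by (cases l) auto
    thus ?thesis by (rule UNIV_eq_I)
  qed
  have "(\<lambda>(j, l). x j * word_prod x l) summable_on UNIV \<times> UNIV"
  proof -
    have "word_prod x summable_on (\<lambda>(j, l). j # l) ` (UNIV \<times> UNIV)"
      using sm by (rule summable_on_subset_banach) auto
    hence "word_prod x \<circ> (\<lambda>(j, l). j # l) summable_on (UNIV \<times> UNIV)"
      by (subst (asm) summable_on_reindex[OF inj])
    thus ?thesis by (simp add: o_def case_prod_unfold)
  qed
  moreover have "((\<lambda>l. x j * word_prod x l) has_sum x j * S) UNIV" for j
    by (intro has_sum_cmult_right S)
  moreover have "((\<lambda>j. x j * S) has_sum infsum x UNIV * S) UNIV"
    using abs_summable_summable[OF summ] by (intro has_sum_cmult_left) auto
  ultimately have "((\<lambda>(j, l). x j * word_prod x l) has_sum infsum x UNIV * S) (UNIV \<times> UNIV)"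
    by (intro has_sum_SigmaI) auto
  hence "(word_prod x has_sum infsum x UNIV * S) ((\<lambda>(j, l). j # l) ` (UNIV \<times> UNIV))"
    by (subst has_sum_reindex[OF inj]) (simp add: o_def case_prod_unfold)
  hence "(word_prod x has_sum 1 + infsum x UNIV * S) UNIV"
    by (subst un, intro has_sum_insert[of "[]" _ "word_prod x", simplified word_prod_Nil]) auto
  hence "S = 1 + infsum x UNIV * S" using S has_sum_unique by blast
  moreover have "infsum x UNIV \<noteq> 1"
  proof
    assume "infsum x UNIV = 1"
    moreover have "cmod (infsum x UNIV) \<le> (\<Sum>\<^sub>\<infinity>j. cmod (x j))"
      using summ by (rule norm_infsum_bound)
    ultimately show False using lt by simp
  qed
  ultimately have "S = 1 / (1 - infsum x UNIV)" by (simp add: field_simps)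
  thus ?thesis using S by simp
qed

text \<open>Vectors vanish off \<open>idx d\<close>, so sums may run over \<open>UNIV\<close> and
  words may use any letters: a word with a letter outside the index set contributes 0.\<close>

lemma Cd_ballD:
  assumes "z \<in> Cd_ball d"
  shows "j \<notin> idx d \<Longrightarrow> z j = 0" "(\<lambda>j. (cmod (z j))\<^sup>2) summable_on UNIV"
    "(\<Sum>\<^sub>\<infinity>j. (cmod (z j))\<^sup>2) < 1"
proof -
  show *: "z j = 0" if "j \<notin> idx d" for j
    using assms that by (auto simp: Cd_ball_def Cd_def)
  have "(\<lambda>j. (cmod (z j))\<^sup>2) summable_on idx d \<longleftrightarrow> (\<lambda>j. (cmod (z j))\<^sup>2) summable_on UNIV"
    by (rule summable_on_cong_neutral) (auto simp: *)
  thus "(\<lambda>j. (cmod (z j))\<^sup>2) summable_on UNIV"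
    using assms by (auto simp: Cd_ball_def Cd_def)
  have "(\<Sum>\<^sub>\<infinity>j. (cmod (z j))\<^sup>2) = (\<Sum>\<^sub>\<infinity>j\<in>idx d. (cmod (z j))\<^sup>2)"
    by (rule infsum_cong_neutral) (auto simp: *)
  thus "(\<Sum>\<^sub>\<infinity>j. (cmod (z j))\<^sup>2) < 1"
    using assms by (auto simp: Cd_ball_def)
qed

lemma norm_mult_le_half_squares: "cmod (a * b) \<le> ((cmod a)\<^sup>2 + (cmod b)\<^sup>2) / 2"
  using sum_squares_bound[of "cmod a" "cmod b"] by (simp add: norm_mult)

text \<open>The arithmetic-geometric mean inequality does the work of Cauchy-Schwarz: for two points
  of the ball the bound is an average of two numbers below 1.\<close>

lemma square_summable_mult:
  assumes "(\<lambda>j. (cmod (a j))\<^sup>2) summable_on A" "(\<lambda>j. (cmod (b j))\<^sup>2) summable_on A"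
  shows "(\<lambda>j. cmod (a j * b j)) summable_on A"
    "(\<Sum>\<^sub>\<infinity>j\<in>A. cmod (a j * b j)) \<le>
      ((\<Sum>\<^sub>\<infinity>j\<in>A. (cmod (a j))\<^sup>2) + (\<Sum>\<^sub>\<infinity>j\<in>A. (cmod (b j))\<^sup>2)) / 2"
proof -
  have h: "((\<lambda>j. ((cmod (a j))\<^sup>2 + (cmod (b j))\<^sup>2) / 2) has_sum
      ((\<Sum>\<^sub>\<infinity>j\<in>A. (cmod (a j))\<^sup>2) + (\<Sum>\<^sub>\<infinity>j\<in>A. (cmod (b j))\<^sup>2)) / 2) A"
    by (intro has_sum_divide_const has_sum_add has_sum_infsum assms)
  show 1: "(\<lambda>j. cmod (a j * b j)) summable_on A"
    by (rule Infinite_Sum.abs_summable_on_comparison_test'[OF has_sum_imp_summable[OF h]])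
      (rule norm_mult_le_half_squares)
  show "(\<Sum>\<^sub>\<infinity>j\<in>A. cmod (a j * b j)) \<le>
      ((\<Sum>\<^sub>\<infinity>j\<in>A. (cmod (a j))\<^sup>2) + (\<Sum>\<^sub>\<infinity>j\<in>A. (cmod (b j))\<^sup>2)) / 2"
    using has_sum_infsum[OF 1] h by (rule has_sum_mono) (rule norm_mult_le_half_squares)
qed

lemma drury_arveson_kernel_has_sum:
  assumes z: "z \<in> Cd_ball d" and w: "w \<in> Cd_ball d"
  shows "((\<lambda>l. word_prod z l * cnj (word_prod w l)) has_sum drury_arveson_kernel d z w) UNIV"
proof -
  define x where "x j = z j * cnj (w j)" for j
  have w': "(\<lambda>j. (cmod (cnj (w j)))\<^sup>2) summable_on UNIV"
    using Cd_ballD(2)[OF w] by simp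
  note sq = square_summable_mult[OF Cd_ballD(2)[OF z] w']
  have "(\<Sum>\<^sub>\<infinity>j. cmod (x j)) < 1"
    using sq(2) Cd_ballD(3)[OF z] Cd_ballD(3)[OF w] unfolding x_def complex_mod_cnj by argo
  from word_prod_has_sum[OF sq(1)[folded x_def] this]
  have "(word_prod x has_sum 1 / (1 - infsum x UNIV)) UNIV" .
  moreover have "infsum x UNIV = Cd_inner d z w"
    unfolding Cd_inner_def x_def by (rule infsum_cong_neutral) (use Cd_ballD(1)[OF z] in auto)
  moreover have "word_prod x = (\<lambda>l. word_prod z l * cnj (word_prod w l))"
    unfolding x_def by (simp add: fun_eq_iff word_prod_mult cnj_word_prod)
  ultimately show ?thesis by (simp add: drury_arveson_kernel_def)
qed

text \<open>The diagonal case of the kernel expansion: these squares add up to the kernel at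
  \<open>(z, z)\<close>.\<close>

lemma square_summable_word_prod:
  assumes "z \<in> Cd_ball d"
  shows "(\<lambda>l. (cmod (word_prod z l))\<^sup>2) summable_on UNIV"
proof -
  have "(\<lambda>l. word_prod z l * cnj (word_prod z l)) summable_on UNIV"
    using drury_arveson_kernel_has_sum[OF assms assms] by (rule has_sum_imp_summable)
  from summable_on_Re[OF this] show ?thesis
    unfolding cmod_power2 by (simp add: power2_eq_square)
qed

section \<open>The Drury--Arveson space\<close>

text \<open>Puts two finite combinations over different nodes on common nodes, adding coefficients
  on the overlap; needed for closure under addition of the graph to which Riesz representation is
  applied.\<close>

lemma sum_extend:
  fixes f :: "'i \<Rightarrow> 'b::semiring_0"
  assumes "finite A" "finite B"
  shows "(\<Sum>x\<in>A \<union> B. ((if x \<in> A then c x else 0) + (if x \<in> B then e x else 0)) * f x) =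
    (\<Sum>x\<in>A. c x * f x) + (\<Sum>x\<in>B. e x * f x)"
proof -
  have "(\<Sum>x\<in>A \<union> B. (if x \<in> A then c x else 0) * f x) = (\<Sum>x\<in>A. c x * f x)"
    by (rule sum.mono_neutral_cong_right) (use assms in auto)
  moreover have "(\<Sum>x\<in>A \<union> B. (if x \<in> B then e x else 0) * f x) = (\<Sum>x\<in>B. e x * f x)"
    by (rule sum.mono_neutral_cong_right) (use assms in auto)
  ultimately show ?thesis by (simp add: distrib_right sum.distrib)
qed

locale drury_arveson =
  rkhs "Cd_ball d" "drury_arveson_kernel d" H ip for d H ip
begin

abbreviation "uball \<equiv> Cd_ball d"
abbreviation "kern \<equiv> kernel_fun uball (drury_arveson_kernel d)"

text \<open>The coefficients are not determined by the function, since permuting a word does not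
  change its monomial.\<close>

definition word_series :: "(nat list \<Rightarrow> complex) \<Rightarrow> (nat \<Rightarrow> complex) \<Rightarrow> complex" where
  "word_series a z = (if z \<in> uball then \<Sum>\<^sub>\<infinity>l. a l * word_prod z l else 0)"

lemma word_series_has_sum:
  assumes "(\<lambda>l. (cmod (a l))\<^sup>2) summable_on UNIV" "z \<in> uball"
  shows "((\<lambda>l. a l * word_prod z l) has_sum word_series a z) UNIV"
proof -
  have "(\<lambda>l. a l * word_prod z l) summable_on UNIV"
    by (rule abs_summable_summable[OF square_summable_mult(1)[OF assms(1)
          square_summable_word_prod[OF assms(2)]]])
  thus ?thesis using assms(2) by (simp add: word_series_def)
qed

lemma word_series_eqI:
  assumes "f \<in> functions_on uball"
    and "\<And>z. z \<in> uball \<Longrightarrow> ((\<lambda>l. a l * word_prod z l) has_sum f z) UNIV"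
  shows "word_series a = f"
proof
  fix z show "word_series a z = f z"
  proof (cases "z \<in> uball")
    case True
    thus ?thesis using infsumI[OF assms(2)[OF True]] by (simp add: word_series_def)
  next
    case False
    thus ?thesis using assms(1) by (simp add: word_series_def functions_on_def)
  qed
qed

lemma ker_has_sum:
  assumes "z \<in> uball" "w \<in> uball"
  shows "((\<lambda>l. cnj (word_prod w l) * word_prod z l) has_sum kern w z) UNIV"
  using drury_arveson_kernel_has_sum[OF assms] assms by (simp add: kernel_fun_def mult.commute)

text \<open>Let \<open>u\<close> be a finite combination of kernels, \<open>t\<close> its word
  coefficients and \<open>p\<close> the value prescribed for its pairing with the series. Then
  \<open>2 Re p - norm_sq u\<close> is the sum of \<open>|a l|^2 - |t l - a l|^2\<close>, so the sum
  of the \<open>|a l|^2\<close> is the bound that Riesz representation asks for. The kernels then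
  identify the representing vector with the series.\<close>

lemma word_series_mem:
  assumes a: "(\<lambda>l. (cmod (a l))\<^sup>2) summable_on UNIV"
  shows "word_series a \<in> H" "norm_sq (word_series a) \<le> (\<Sum>\<^sub>\<infinity>l. (cmod (a l))\<^sup>2)"
proof -
  define h where "h = word_series a"
  \<comment> \<open>\<open>U A c\<close> ranges over the finite kernel combinations, and
    \<open>Q A c\<close> is the value \<open>ip (U A c) h\<close> must take if \<open>h\<close> is
    in \<open>H\<close>.\<close>
  define U where "U A c = (\<lambda>y. \<Sum>x\<in>A. c x * kern x y)" for A c
  define Q where "Q A c = (\<Sum>x\<in>A. c x * cnj (h x))" for A c
  define R where "R = {(U A c, Q A c) | A c. finite A \<and> A \<subseteq> uball}"
  have UH: "U A c \<in> H" if "A \<subseteq> uball" for A c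
    unfolding U_def using that by (intro sum_mem scale_mem kernel_mem) auto
  have bound: "2 * Re (Q A c) - norm_sq (U A c) \<le> (\<Sum>\<^sub>\<infinity>l. (cmod (a l))\<^sup>2)"
    if A: "A \<subseteq> uball" for A c
  proof -
    \<comment> \<open>The coefficients of \<open>U A c\<close> as a word series: its squared norm is
      the sum of \<open>|t l|^2\<close>, and \<open>Q A c\<close> the sum of
      \<open>t l * cnj (a l)\<close>.\<close>
    define t where "t l = (\<Sum>x\<in>A. c x * cnj (word_prod x l))" for l
    have "ip (U A c) (U A c) = (\<Sum>x\<in>A. c x * cnj (U A c x))"
    proof -
      have "ip (kern x) (U A c) = cnj (U A c x)" if "x \<in> A" for x
        using that A ip_cnj[OF UH[OF A] kernel_mem, of x c] reproducing[OF UH[OF A], of x c] by auto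
      thus ?thesis
        unfolding U_def using A UH[OF A, of c]
        by (subst ip_sum) (auto simp: U_def kernel_mem)
    qed
    moreover have "((\<lambda>l. \<Sum>x\<in>A. c x * cnj (\<Sum>y\<in>A. c y * (cnj (word_prod y l) * word_prod x l)))
        has_sum (\<Sum>x\<in>A. c x * cnj (U A c x))) UNIV"
      unfolding U_def using A
      by (intro has_sum_sum has_sum_cmult_right ker_has_sum has_sum_cnj_iff[THEN iffD2]) auto
    moreover have "(\<Sum>x\<in>A. c x * cnj (\<Sum>y\<in>A. c y * (cnj (word_prod y l) * word_prod x l))) =
        of_real ((cmod (t l))\<^sup>2)" for l
    proof -
      have "(\<Sum>x\<in>A. c x * cnj (\<Sum>y\<in>A. c y * (cnj (word_prod y l) * word_prod x l))) =
          t l * cnj (t l)"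
        unfolding t_def
        by (simp add: sum_distrib_left sum_distrib_right mult_ac) (rule sum.swap)
      thus ?thesis by (simp only: complex_norm_square)
    qed
    ultimately have "((\<lambda>l. complex_of_real ((cmod (t l))\<^sup>2)) has_sum ip (U A c) (U A c)) UNIV"
      by simp
    from has_sum_Re[OF this] have 1: "((\<lambda>l. (cmod (t l))\<^sup>2) has_sum norm_sq (U A c)) UNIV"
      by (simp add: norm_sq_def)
    have "((\<lambda>l. \<Sum>x\<in>A. c x * cnj (a l * word_prod x l)) has_sum Q A c) UNIV"
      unfolding Q_def h_def using A
      by (intro has_sum_sum has_sum_cmult_right has_sum_cnj_iff[THEN iffD2] word_series_has_sum a) auto
    also have "(\<lambda>l. \<Sum>x\<in>A. c x * cnj (a l * word_prod x l)) = (\<lambda>l. t l * cnj (a l))"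
      unfolding t_def by (simp add: sum_distrib_left mult_ac)
    finally have "((\<lambda>l. Re (t l * cnj (a l))) has_sum Re (Q A c)) UNIV"
      by (rule has_sum_Re)
    from has_sum_add[OF has_sum_add[OF 1 has_sum_infsum[OF a]] has_sum_cmult_right[OF this, of "-2"]]
    have "((\<lambda>l. (cmod (t l))\<^sup>2 + (cmod (a l))\<^sup>2 + - 2 * Re (t l * cnj (a l))) has_sum
        norm_sq (U A c) + (\<Sum>\<^sub>\<infinity>l. (cmod (a l))\<^sup>2) + - 2 * Re (Q A c)) UNIV" .
    also have "(\<lambda>l. (cmod (t l))\<^sup>2 + (cmod (a l))\<^sup>2 + - 2 * Re (t l * cnj (a l))) =
        (\<lambda>l. (cmod (t l - a l))\<^sup>2)"
      unfolding cmod_power2 by (rule ext) (simp add: power2_eq_square algebra_simps)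
    finally have "0 \<le> norm_sq (U A c) + (\<Sum>\<^sub>\<infinity>l. (cmod (a l))\<^sup>2) + - 2 * Re (Q A c)"
      by (rule has_sum_nonneg) simp
    thus ?thesis by argo
  qed
  have "\<exists>v\<in>H. (\<forall>(u, p)\<in>R. ip u v = p) \<and> norm_sq v \<le> (\<Sum>\<^sub>\<infinity>l. (cmod (a l))\<^sup>2)"
  proof (rule riesz_representation)
    show "R \<noteq> {}" by (auto simp: R_def)
    fix u p assume up: "(u, p) \<in> R"
    then obtain A c where Ac: "u = U A c" "p = Q A c" "finite A" "A \<subseteq> uball"
      by (auto simp: R_def)
    show "u \<in> H" using Ac UH by simp
    show "2 * Re p - norm_sq u \<le> (\<Sum>\<^sub>\<infinity>l. (cmod (a l))\<^sup>2)" using Ac bound by simp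
    show "(\<lambda>x. e * u x, e * p) \<in> R" for e
    proof -
      have "(\<lambda>x. e * u x) = U A (\<lambda>x. e * c x)" "e * p = Q A (\<lambda>x. e * c x)"
        by (simp_all add: Ac U_def Q_def sum_distrib_left mult.assoc)
      thus ?thesis using Ac unfolding R_def by blast
    qed
    show "(\<lambda>x. u x + v x, p + q) \<in> R" if vq: "(v, q) \<in> R" for v q
    proof -
      from vq obtain B e where Be: "v = U B e" "q = Q B e" "finite B" "B \<subseteq> uball"
        by (auto simp: R_def)
      define g where "g x = (if x \<in> A then c x else 0) + (if x \<in> B then e x else 0)" for x
      have "(\<lambda>x. u x + v x) = U (A \<union> B) g" "p + q = Q (A \<union> B) g"
        by (simp_all only: Ac Be U_def Q_def g_def sum_extend[OF Ac(3) Be(3)])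
      moreover have "finite (A \<union> B)" "A \<union> B \<subseteq> uball" using Ac Be by auto
      ultimately show ?thesis unfolding R_def by blast
    qed
  qed
  then obtain v where v: "v \<in> H" "\<forall>(u, p)\<in>R. ip u v = p"
    "norm_sq v \<le> (\<Sum>\<^sub>\<infinity>l. (cmod (a l))\<^sup>2)" by blast
  have "v = h"
  proof
    fix x show "v x = h x"
    proof (cases "x \<in> uball")
      case True
      \<comment> \<open>A single kernel with coefficient 1 turns the representation property into
        equality of values at \<open>x\<close>.\<close>
      have "(U {x} (\<lambda>_. 1), Q {x} (\<lambda>_. 1)) \<in> R" unfolding R_def using True by blast
      from bspec[OF v(2) this] have "ip (U {x} (\<lambda>_. 1)) v = Q {x} (\<lambda>_. 1)" by simp
      hence "ip (kern x) v = cnj (h x)" by (simp add: U_def Q_def)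
      moreover have "ip (kern x) v = cnj (v x)"
        using ip_cnj[OF v(1) kernel_mem[OF True]] reproducing[OF v(1) True] by simp
      ultimately show ?thesis by simp
    next
      case False
      thus ?thesis using v(1) functions_on_X by (auto simp: h_def word_series_def functions_on_def)
    qed
  qed
  with v(1,3) show "word_series a \<in> H" "norm_sq (word_series a) \<le> (\<Sum>\<^sub>\<infinity>l. (cmod (a l))\<^sup>2)"
    by (simp_all add: h_def)
qed

section \<open>Word coefficients of members of the space\<close>

definition word_fun :: "nat list \<Rightarrow> (nat \<Rightarrow> complex) \<Rightarrow> complex" where
  "word_fun l z = (if z \<in> uball then word_prod z l else 0)"

lemma word_series_finite:
  assumes "finite F"
  shows "word_series (\<lambda>l. if l \<in> F then a l else 0) = (\<lambda>z. \<Sum>l\<in>F. a l * word_fun l z)"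
proof (rule word_series_eqI)
  fix z assume "z \<in> uball"
  thus "((\<lambda>l. (if l \<in> F then a l else 0) * word_prod z l) has_sum
      (\<Sum>l\<in>F. a l * word_fun l z)) UNIV"
    using assms by (intro has_sum_finite_neutralI[of F]) (auto simp: word_fun_def)
qed (simp add: functions_on_def word_fun_def)

lemma square_summable_finite:
  assumes "finite F"
  shows "((\<lambda>l. (cmod (if l \<in> F then a l else 0))\<^sup>2) has_sum (\<Sum>l\<in>F. (cmod (a l))\<^sup>2)) UNIV"
  using assms by (intro has_sum_finite_neutralI[of F]) auto

lemma word_fun_mem: "word_fun l \<in> H"
proof -
  have "word_series (\<lambda>k. if k \<in> {l} then 1 else 0) \<in> H"
    by (intro word_series_mem has_sum_imp_summable[OF square_summable_finite]) simp
  thus ?thesis using word_series_finite[of "{l}" "\<lambda>_. 1"] by simp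
qed

text \<open>The word functions are not orthonormal, but a finite combination has squared norm at
  most that of its coefficients. Taking the \<open>ip g (word_fun l)\<close> as coefficients, with
  \<open>S\<close> the sum of their squared moduli, gives
  \<open>0 \<le> norm_sq (g - p) \<le> norm_sq g - S\<close>.\<close>

lemma bessel:
  assumes g: "g \<in> H"
  shows "(\<lambda>l. (cmod (ip g (word_fun l)))\<^sup>2) summable_on UNIV"
proof (rule nonneg_bdd_above_summable_on)
  show "bdd_above (sum (\<lambda>l. (cmod (ip g (word_fun l)))\<^sup>2) ` {F. F \<subseteq> UNIV \<and> finite F})"
  proof (rule bdd_aboveI2)
    fix F :: "nat list set" assume "F \<in> {F. F \<subseteq> UNIV \<and> finite F}"
    hence F: "finite F" by simp
    define c where "c l = ip g (word_fun l)" for l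
    define p where "p = (\<lambda>z. \<Sum>l\<in>F. c l * word_fun l z)"
    define S where "S = (\<Sum>l\<in>F. (cmod (c l))\<^sup>2)"
    have p: "p \<in> H" unfolding p_def by (intro sum_mem scale_mem word_fun_mem)
    have "norm_sq p \<le> S"
      unfolding p_def S_def infsumI[OF square_summable_finite[OF F], symmetric]
        word_series_finite[OF F, symmetric]
      by (rule word_series_mem[OF has_sum_imp_summable[OF square_summable_finite[OF F]]])
    moreover have "ip g p = (\<Sum>l\<in>F. cnj (c l) * c l)"
      unfolding p_def c_def by (intro ip_sum_right word_fun_mem g)
    hence "Re (ip g p) = S"
      unfolding S_def cmod_power2 by (simp add: power2_eq_square)
    moreover have "0 \<le> norm_sq (\<lambda>z. g z - p z)" by (intro norm_sq_nonneg diff_mem g p)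
    moreover note norm_sq_diff[OF g p]
    ultimately have "S \<le> norm_sq g" by argo
    thus "sum (\<lambda>l. (cmod (ip g (word_fun l)))\<^sup>2) F \<le> norm_sq g"
      by (simp add: S_def c_def)
  qed
qed simp

text \<open>The kernel at \<open>w\<close> is the word series with coefficients
  \<open>cnj (word_prod w l)\<close>, and its tails are small in norm by the bound on series. Its
  partial sums thus converge in \<open>H\<close>, and pairing them with \<open>g\<close> gives the
  expansion.\<close>

lemma word_expansion:
  assumes g: "g \<in> H" and w: "w \<in> uball"
  shows "((\<lambda>l. ip g (word_fun l) * word_prod w l) has_sum g w) UNIV"
proof -
  define b where "b l = cnj (word_prod w l)" for l
  have b: "(\<lambda>l. (cmod (b l))\<^sup>2) summable_on UNIV"
    using square_summable_word_prod[OF w] by (simp add: b_def)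
  define S where "S = (\<Sum>\<^sub>\<infinity>l. (cmod (b l))\<^sup>2)"
  have bS: "((\<lambda>l. (cmod (b l))\<^sup>2) has_sum S) UNIV" using b by (simp add: S_def)
  have est: "cmod ((\<Sum>l\<in>F. ip g (word_fun l) * word_prod w l) - g w) \<le>
      sqrt (norm_sq g) * sqrt (S - (\<Sum>l\<in>F. (cmod (b l))\<^sup>2))" if F: "finite F" for F
  proof -
    define p where "p = (\<lambda>z. \<Sum>l\<in>F. b l * word_fun l z)"
    \<comment> \<open>The coefficients of the tail, which is the kernel at \<open>w\<close> minus
      the partial sum \<open>p\<close>.\<close>
    define a where "a l = (if l \<in> F then 0 else b l)" for l
    have p: "p \<in> H" unfolding p_def by (intro sum_mem scale_mem word_fun_mem)
    have kw: "kern w \<in> H" by (rule kernel_mem[OF w])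
    have "((\<lambda>l. (cmod (b l))\<^sup>2 - (cmod (if l \<in> F then b l else 0))\<^sup>2) has_sum
        (S - (\<Sum>l\<in>F. (cmod (b l))\<^sup>2))) UNIV"
      using has_sum_add[OF bS has_sum_uminusI[OF square_summable_finite[OF F, of b]]] by simp
    also have "(\<lambda>l. (cmod (b l))\<^sup>2 - (cmod (if l \<in> F then b l else 0))\<^sup>2) = (\<lambda>l. (cmod (a l))\<^sup>2)"
      by (auto simp: a_def)
    finally have aS: "((\<lambda>l. (cmod (a l))\<^sup>2) has_sum (S - (\<Sum>l\<in>F. (cmod (b l))\<^sup>2))) UNIV" .
    have "word_series a = (\<lambda>z. kern w z - p z)"
    proof (rule word_series_eqI)
      show "(\<lambda>z. kern w z - p z) \<in> functions_on uball"
        by (simp add: functions_on_def kernel_fun_def p_def word_fun_def)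
      fix z assume z: "z \<in> uball"
      have "((\<lambda>l. (if l \<in> F then b l else 0) * word_prod z l) has_sum p z) UNIV"
        unfolding p_def using F z
        by (intro has_sum_finite_neutralI[of F]) (auto simp: word_fun_def)
      from has_sum_add[OF ker_has_sum[OF z w] has_sum_uminusI[OF this]]
      have "((\<lambda>l. b l * word_prod z l - (if l \<in> F then b l else 0) * word_prod z l) has_sum
          kern w z - p z) UNIV" by (simp add: b_def)
      also have "(\<lambda>l. b l * word_prod z l - (if l \<in> F then b l else 0) * word_prod z l) =
          (\<lambda>l. a l * word_prod z l)" by (auto simp: a_def)
      finally show "((\<lambda>l. a l * word_prod z l) has_sum kern w z - p z) UNIV" .
    qed
    with word_series_mem(2)[OF has_sum_imp_summable[OF aS]]
    have nd: "norm_sq (\<lambda>z. kern w z - p z) \<le> S - (\<Sum>l\<in>F. (cmod (b l))\<^sup>2)"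
      by (simp add: infsumI[OF aS])
    have "ip g p = (\<Sum>l\<in>F. ip g (word_fun l) * word_prod w l)"
      unfolding p_def using g by (subst ip_sum_right) (auto simp: word_fun_mem b_def mult.commute)
    moreover have "ip g (kern w) = g w" by (rule reproducing[OF g w])
    ultimately have "(\<Sum>l\<in>F. ip g (word_fun l) * word_prod w l) - g w =
        - ip g (\<lambda>z. kern w z - p z)"
      by (simp add: ip_diff_right[OF kw p g])
    hence "cmod ((\<Sum>l\<in>F. ip g (word_fun l) * word_prod w l) - g w) \<le>
        sqrt (norm_sq g) * sqrt (norm_sq (\<lambda>z. kern w z - p z))"
      using norm_ip_le[OF g diff_mem[OF kw p]] by simp
    also have "\<dots> \<le> sqrt (norm_sq g) * sqrt (S - (\<Sum>l\<in>F. (cmod (b l))\<^sup>2))"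
      using nd norm_sq_nonneg[OF g] by (intro mult_left_mono) auto
    finally show ?thesis .
  qed
  have "((\<lambda>F. sqrt (norm_sq g) * sqrt (S - (\<Sum>l\<in>F. (cmod (b l))\<^sup>2))) \<longlongrightarrow>
      sqrt (norm_sq g) * sqrt (S - S)) (finite_subsets_at_top UNIV)"
    using bS unfolding has_sum_def by (intro tendsto_intros)
  hence "((\<lambda>F. sqrt (norm_sq g) * sqrt (S - (\<Sum>l\<in>F. (cmod (b l))\<^sup>2))) \<longlongrightarrow> 0)
      (finite_subsets_at_top UNIV)" by simp
  hence "((\<lambda>F. (\<Sum>l\<in>F. ip g (word_fun l) * word_prod w l) - g w) \<longlongrightarrow> 0) (finite_subsets_at_top UNIV)"
    by (rule Lim_null_comparison[rotated])
      (use est in \<open>auto simp: eventually_finite_subsets_at_top\<close>)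
  thus ?thesis unfolding has_sum_def by (simp add: LIM_zero_iff)
qed

section \<open>Polynomials as multipliers\<close>

abbreviation "multipliers \<equiv> multiplier_algebra uball H"

definition on_ball :: "((nat \<Rightarrow> complex) \<Rightarrow> complex) \<Rightarrow> (nat \<Rightarrow> complex) \<Rightarrow> complex" where
  "on_ball f z = (if z \<in> uball then f z else 0)"

text \<open>Multiplying by the \<open>j\<close>-th coordinate prepends the letter \<open>j\<close>
  to every word, which moves the coefficients injectively and so keeps them square-summable.\<close>

lemma coordinate_multiplier: "on_ball (\<lambda>z. z j) \<in> multipliers"
proof -
  have "(\<lambda>z. on_ball (\<lambda>z. z j) z * f z) \<in> H" if f: "f \<in> H" for f
  proof -
    define c where "c l = ip f (word_fun l)" for l
    define a where "a l = (case l of [] \<Rightarrow> 0 | i # k \<Rightarrow> if i = j then c k else 0)" for l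
    have inj: "inj (Cons j)" by (auto simp: inj_on_def)
    have a0: "a l = 0" if "l \<notin> range (Cons j)" for l
      using that by (auto simp: a_def split: list.splits)
    have aj: "a (j # l) = c l" for l by (simp add: a_def)
    have "(\<lambda>l. (cmod (a l))\<^sup>2) summable_on range (Cons j)"
      using bessel[OF f] by (subst summable_on_reindex[OF inj]) (simp add: o_def aj c_def)
    hence a: "(\<lambda>l. (cmod (a l))\<^sup>2) summable_on UNIV"
      by (subst (asm) summable_on_cong_neutral[where T = UNIV]) (auto simp: a0)
    have "word_series a = (\<lambda>z. on_ball (\<lambda>z. z j) z * f z)"
    proof (rule word_series_eqI)
      fix z assume z: "z \<in> uball"
      have "((\<lambda>l. z j * (c l * word_prod z l)) has_sum z j * f z) UNIV"
        unfolding c_def by (intro has_sum_cmult_right word_expansion f z)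
      hence "((\<lambda>l. a l * word_prod z l) has_sum z j * f z) (range (Cons j))"
        by (subst has_sum_reindex[OF inj]) (simp add: o_def aj mult_ac)
      hence "((\<lambda>l. a l * word_prod z l) has_sum z j * f z) UNIV"
        by (subst (asm) has_sum_cong_neutral[where T = UNIV]) (auto simp: a0)
      thus "((\<lambda>l. a l * word_prod z l) has_sum on_ball (\<lambda>z. z j) z * f z) UNIV"
        using z by (simp add: on_ball_def)
    qed (simp add: functions_on_def on_ball_def)
    thus ?thesis using word_series_mem(1)[OF a] by simp
  qed
  thus ?thesis by (simp add: multiplier_algebra_def functions_on_def on_ball_def)
qed

lemma const_multiplier: "on_ball (\<lambda>z. c) \<in> multipliers"
proof -
  have "(\<lambda>z. on_ball (\<lambda>z. c) z * f z) = (\<lambda>z. c * f z)" if "f \<in> H" for f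
    using that functions_on_X by (auto simp: on_ball_def functions_on_def fun_eq_iff)
  thus ?thesis by (simp add: multiplier_algebra_def functions_on_def on_ball_def scale_mem)
qed

lemma mult_multiplier:
  assumes "on_ball f \<in> multipliers" "on_ball g \<in> multipliers"
  shows "on_ball (\<lambda>z. f z * g z) \<in> multipliers"
proof -
  have "(\<lambda>z. on_ball (\<lambda>z. f z * g z) z * h z) = (\<lambda>z. on_ball f z * (on_ball g z * h z))" for h
    by (auto simp: on_ball_def)
  thus ?thesis using assms by (auto simp: multiplier_algebra_def functions_on_def on_ball_def)
qed

lemma diff_multiplier:
  assumes "on_ball f \<in> multipliers" "on_ball g \<in> multipliers"
  shows "on_ball (\<lambda>z. f z - g z) \<in> multipliers"
proof -
  have "(\<lambda>z. on_ball (\<lambda>z. f z - g z) z * h z) = (\<lambda>z. on_ball f z * h z - on_ball g z * h z)" for h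
    by (auto simp: on_ball_def algebra_simps)
  thus ?thesis using assms
    by (auto simp: multiplier_algebra_def functions_on_def on_ball_def intro!: diff_mem)
qed

lemma power_multiplier:
  assumes "on_ball f \<in> multipliers"
  shows "on_ball (\<lambda>z. f z ^ m) \<in> multipliers"
proof (induction m)
  case 0
  show ?case using const_multiplier[of 1] by simp
next
  case (Suc m)
  show ?case using mult_multiplier[OF assms Suc] by simp
qed

lemma prod_multiplier:
  assumes "finite A" "\<And>i. i \<in> A \<Longrightarrow> on_ball (f i) \<in> multipliers"
  shows "on_ball (\<lambda>z. \<Prod>i\<in>A. f i z) \<in> multipliers"
  using assms
proof (induction A rule: finite_induct)
  case empty
  show ?case using const_multiplier[of 1] by simp
next
  case (insert i A)
  have "on_ball (f i) \<in> multipliers" "on_ball (\<lambda>z. \<Prod>i\<in>A. f i z) \<in> multipliers"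
    using insert by blast+
  from mult_multiplier[OF this] show ?case using insert.hyps by simp
qed

text \<open>The constant 1 is the function of the empty word, so it lies in \<open>H\<close> and can
  be multiplied.\<close>

lemma multiplier_mem:
  assumes "g \<in> multipliers"
  shows "g \<in> H"
proof -
  have "(\<lambda>z. g z * word_fun [] z) \<in> H"
    using assms word_fun_mem by (auto simp: multiplier_algebra_def)
  also have "(\<lambda>z. g z * word_fun [] z) = g"
    using assms by (auto simp: multiplier_algebra_def functions_on_def word_fun_def fun_eq_iff)
  finally show ?thesis .
qed

end

section \<open>Integer relations and Laurent monomials\<close>

definition support :: "('i \<Rightarrow> int) \<Rightarrow> 'i set" where
  "support v = {j. v j \<noteq> 0}"

text \<open>For \<open>a j = ln (n j)\<close> this is the lattice of multiplicative relations among
  the frequencies. Finite support is explicit because \<open>I\<close> may be infinite.\<close>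

definition int_relation :: "'i set \<Rightarrow> ('i \<Rightarrow> real) \<Rightarrow> ('i \<Rightarrow> int) \<Rightarrow> bool" where
  "int_relation I a v \<longleftrightarrow>
    finite (support v) \<and> support v \<subseteq> I \<and> (\<Sum>j\<in>support v. of_int (v j) * a j) = 0"

lemma int_relationI:
  assumes "finite S" "support v \<subseteq> S" "support v \<subseteq> I" "(\<Sum>j\<in>S. of_int (v j) * a j) = 0"
  shows "int_relation I a v"
proof -
  have "(\<Sum>j\<in>support v. of_int (v j) * a j) = (\<Sum>j\<in>S. of_int (v j) * a j)"
    using assms(1,2) by (intro sum.mono_neutral_left) (auto simp: support_def)
  thus ?thesis using assms by (auto simp: int_relation_def intro: finite_subset)
qed

lemma int_relation_sum:
  assumes "int_relation I a v" "finite S" "support v \<subseteq> S"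
  shows "(\<Sum>j\<in>S. of_int (v j) * a j) = 0"
proof -
  have "(\<Sum>j\<in>support v. of_int (v j) * a j) = (\<Sum>j\<in>S. of_int (v j) * a j)"
    using assms by (intro sum.mono_neutral_left) (auto simp: support_def)
  thus ?thesis using assms by (simp add: int_relation_def)
qed

lemma int_relation_linear:
  assumes v: "int_relation I a v" and x: "int_relation I a x"
  shows "int_relation I a (\<lambda>j. p * v j + q * x j)"
proof (rule int_relationI)
  define S where "S = support v \<union> support x"
  show "finite S" using v x by (simp add: S_def int_relation_def)
  show "support (\<lambda>j. p * v j + q * x j) \<subseteq> S" by (auto simp: S_def support_def)
  thus "support (\<lambda>j. p * v j + q * x j) \<subseteq> I"
    using v x by (auto simp: S_def int_relation_def)
  have "(\<Sum>j\<in>S. of_int (p * v j + q * x j) * a j) =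
      of_int p * (\<Sum>j\<in>S. of_int (v j) * a j) + of_int q * (\<Sum>j\<in>S. of_int (x j) * a j)"
    by (simp add: sum_distrib_left sum.distrib algebra_simps)
  also have "\<dots> = 0"
    using int_relation_sum[OF v \<open>finite S\<close>] int_relation_sum[OF x \<open>finite S\<close>]
    by (simp add: S_def)
  finally show "(\<Sum>j\<in>S. of_int (p * v j + q * x j) * a j) = 0" .
qed

lemma int_relation_uminus:
  assumes "int_relation I a v"
  shows "int_relation I a (\<lambda>j. - v j)"
  using int_relation_linear[OF assms assms, of "-1" 0] by simp

text \<open>Multiplicative in \<open>v\<close> only where \<open>w\<close> does not vanish:
  \<open>powi\<close> sends base 0 to 0 for every nonzero exponent, negative ones included.\<close>

definition laurent_monomial :: "('i \<Rightarrow> complex) \<Rightarrow> ('i \<Rightarrow> int) \<Rightarrow> complex" where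
  "laurent_monomial w v = (\<Prod>j\<in>support v. w j powi v j)"

lemma laurent_monomial_eq:
  assumes "finite S" "support v \<subseteq> S"
  shows "laurent_monomial w v = (\<Prod>j\<in>S. w j powi v j)"
  unfolding laurent_monomial_def using assms
  by (intro prod.mono_neutral_left) (auto simp: support_def)

lemma prod_power_int: "(\<Prod>j\<in>A. f j) powi m = (\<Prod>j\<in>A. f j powi m)" for f :: "'i \<Rightarrow> complex"
  by (induction A rule: infinite_finite_induct) (simp_all add: power_int_mult_distrib)

lemma laurent_monomial_linear:
  assumes "finite (support v)" "finite (support x)"
    and "\<And>j. j \<in> support v \<union> support x \<Longrightarrow> w j \<noteq> 0"
  shows "laurent_monomial w (\<lambda>j. p * v j + q * x j) =
    laurent_monomial w v powi p * laurent_monomial w x powi q"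
proof -
  define S where "S = support v \<union> support x"
  have S: "finite S" using assms by (simp add: S_def)
  have "laurent_monomial w (\<lambda>j. p * v j + q * x j) = (\<Prod>j\<in>S. w j powi (p * v j + q * x j))"
    by (intro laurent_monomial_eq S) (auto simp: S_def support_def)
  also have "\<dots> = (\<Prod>j\<in>S. (w j powi v j) powi p * (w j powi x j) powi q)"
    using assms(3)
    by (intro prod.cong) (auto simp: S_def power_int_add power_int_mult[symmetric] mult.commute)
  also have "\<dots> = (\<Prod>j\<in>S. w j powi v j) powi p * (\<Prod>j\<in>S. w j powi x j) powi q"
    by (simp add: prod.distrib prod_power_int)
  also have "(\<Prod>j\<in>S. w j powi v j) = laurent_monomial w v"
    by (rule laurent_monomial_eq[symmetric]) (use S in \<open>auto simp: S_def\<close>)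
  also have "(\<Prod>j\<in>S. w j powi x j) = laurent_monomial w x"
    by (rule laurent_monomial_eq[symmetric]) (use S in \<open>auto simp: S_def\<close>)
  finally show ?thesis .
qed

text \<open>The exponents \<open>m\<close> with \<open>c powi m = 1\<close> form a subgroup of the
  integers; Bezout's identity puts the gcd into it.\<close>

lemma power_int_Gcd_eq_1:
  fixes c :: complex
  assumes "finite A" "\<And>m. m \<in> A \<Longrightarrow> c powi m = 1" "c \<noteq> 0"
  shows "c powi Gcd A = 1"
  using assms(1,2)
proof (induction A rule: finite_induct)
  case (insert m A)
  obtain u v where "u * m + v * Gcd A = gcd m (Gcd A)"
    using bezout_int by blast
  hence "c powi Gcd (insert m A) = (c powi m) powi u * (c powi Gcd A) powi v"
    using assms(3) by (simp add: power_int_add power_int_mult[symmetric] mult.commute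
        flip: \<open>u * m + v * Gcd A = gcd m (Gcd A)\<close>)
  thus ?case using insert by simp
qed simp

text \<open>Circuits need not form a \<open>\<int>\<close>-basis of the relation lattice, but a primitive relation \<open>x\<close>
  suffices: each \<open>x j v - v j x\<close> has smaller support than \<open>v\<close>, so by induction the powers of the
  monomial of \<open>v\<close> with exponents \<open>x j\<close> are all \<open>1\<close>, hence so is the power with their gcd.\<close>

lemma laurent_monomial_eq_1:
  assumes circuit: "\<And>v. int_relation I a v \<Longrightarrow> support v \<noteq> {} \<Longrightarrow> \<forall>j\<in>support v. w j \<noteq> 0 \<Longrightarrow>
      \<exists>x. int_relation I a x \<and> support x \<subseteq> support v \<and> Gcd (x ` support x) = 1 \<and>
        laurent_monomial w x = 1"
    and "int_relation I a v" "\<forall>j\<in>support v. w j \<noteq> 0"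
  shows "laurent_monomial w v = 1"
  using assms(2,3)
proof (induction "card (support v)" arbitrary: v rule: less_induct)
  case less
  show ?case
  proof (cases "support v = {}")
    case True
    thus ?thesis by (simp add: laurent_monomial_def)
  next
    case False
    then obtain x where x: "int_relation I a x" "support x \<subseteq> support v"
      "Gcd (x ` support x) = 1" "laurent_monomial w x = 1"
      using circuit less.prems by blast
    have fin: "finite (support v)" "finite (support x)"
      using less.prems x by (auto simp: int_relation_def)
    let ?c = "laurent_monomial w v"
    have c0: "?c \<noteq> 0" using less.prems fin by (auto simp: laurent_monomial_def)
    have "?c powi m = 1" if "m \<in> x ` support x" for m
    proof -
      from that obtain j where j: "j \<in> support x" "m = x j" by blast
      define y where "y i = x j * v i + (- v j) * x i" for i
      have rel: "int_relation I a y"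
        unfolding y_def by (rule int_relation_linear[OF less.prems(1) x(1)])
      have "support y \<subseteq> support v - {j}"
        using x(2) by (auto simp: y_def support_def)
      hence sub: "support y \<subset> support v" using j x(2) by blast
      hence "card (support y) < card (support v)" using fin psubset_card_mono by blast
      hence "laurent_monomial w y = 1"
        using less.hyps[OF _ rel] sub less.prems(2) by blast
      thus ?thesis
        unfolding y_def using less.prems(2) x(2,4) fin j
        by (subst (asm) laurent_monomial_linear) auto
    qed
    with c0 fin(2) have "?c powi Gcd (x ` support x) = 1"
      by (intro power_int_Gcd_eq_1) auto
    thus ?thesis using x(3) by simp
  qed
qed

text \<open>Subtracting from \<open>v\<close> the largest multiple of \<open>x\<close> that changes no sign leaves a relation of
  smaller support that is conformal to \<open>v\<close>.\<close>

lemma zero_on_negative_part: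
  fixes w :: "'i \<Rightarrow> complex"
  assumes circuit: "\<And>v. int_relation I a v \<Longrightarrow> support v \<noteq> {} \<Longrightarrow>
      \<exists>x. int_relation I a x \<and> support x \<noteq> {} \<and> support x \<subseteq> support v \<and>
        ((\<exists>j. x j > 0 \<and> w j = 0) \<longleftrightarrow> (\<exists>j. x j < 0 \<and> w j = 0))"
    and "int_relation I a v" "v j > 0" "w j = 0"
  shows "\<exists>i. v i < 0 \<and> w i = 0"
  using assms(2-4)
proof (induction "card (support v)" arbitrary: v j rule: less_induct)
  case less
  have fin: "finite (support v)" using less.prems by (simp add: int_relation_def)
  have "support v \<noteq> {}" using less.prems(2) by (force simp: support_def)
  then obtain x0 where x0: "int_relation I a x0" "support x0 \<noteq> {}" "support x0 \<subseteq> support v"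
    "(\<exists>j. x0 j > 0 \<and> w j = 0) \<longleftrightarrow> (\<exists>j. x0 j < 0 \<and> w j = 0)"
    using circuit less.prems by blast
  \<comment> \<open>A sign shared with \<open>v\<close> is needed at some coordinate, so
    \<open>x0\<close> may have to be negated. The hypothesis on zeros is an equivalence and survives
    this.\<close>
  obtain x k where x: "int_relation I a x" "support x \<subseteq> support v"
    "(\<exists>j. x j > 0 \<and> w j = 0) \<longrightarrow> (\<exists>j. x j < 0 \<and> w j = 0)" and k: "x k * v k > 0"
  proof -
    from x0 obtain k where k: "x0 k \<noteq> 0" "v k \<noteq> 0" by (auto simp: support_def)
    show ?thesis
    proof (cases "x0 k * v k > 0")
      case True
      thus ?thesis using that x0 by blast
    next
      case False
      hence "- x0 k * v k > 0" using k by (auto simp: not_less le_less mult_less_0_iff)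
      moreover have "support (\<lambda>j. - x0 j) = support x0" by (simp add: support_def)
      ultimately show ?thesis
        using that[of "\<lambda>j. - x0 j" k] x0 int_relation_uminus[OF x0(1)] by simp
    qed
  qed
  \<comment> \<open>Only where \<open>x\<close> and \<open>v\<close> share a sign can subtracting a
    positive multiple of \<open>x\<close> bring a coordinate to zero; the least ratio
    \<open>r\<close> over \<open>T\<close> is the first multiple at which this happens.\<close>
  define T where "T = {i. x i * v i > 0}"
  define r where "r i = \<bar>real_of_int (v i)\<bar> / \<bar>real_of_int (x i)\<bar>" for i
  have "T \<subseteq> support v" by (auto simp: T_def support_def)
  hence T: "finite T" "T \<noteq> {}"
    using k finite_subset[OF _ fin] by (auto simp: T_def)
  define i0 where "i0 = arg_min_on r T"
  have i0: "i0 \<in> T" and min: "\<And>i. i \<in> T \<Longrightarrow> r i0 \<le> r i"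
    unfolding i0_def using T by (auto intro: arg_min_if_finite(1) arg_min_least)
  have nz: "x i0 \<noteq> 0" "v i0 \<noteq> 0" using i0 by (auto simp: T_def)
  have cross: "\<bar>v i0\<bar> * \<bar>x i\<bar> \<le> \<bar>v i\<bar> * \<bar>x i0\<bar>" if "i \<in> T" for i
  proof -
    have "x i \<noteq> 0" using that by (auto simp: T_def)
    hence "\<bar>real_of_int (v i0)\<bar> * \<bar>real_of_int (x i)\<bar> \<le> \<bar>real_of_int (v i)\<bar> * \<bar>real_of_int (x i0)\<bar>"
      using min[OF that] nz by (simp add: r_def field_simps)
    thus ?thesis by (simp flip: of_int_abs of_int_mult)
  qed
  \<comment> \<open>The difference \<open>v - r i0 * x\<close> for same-signed entries at
    \<open>i0\<close>, multiplied by \<open>|x i0|\<close> to stay integral; it vanishes at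
    \<open>i0\<close>.\<close>
  define y where "y i = \<bar>x i0\<bar> * v i + (- \<bar>v i0\<bar>) * x i" for i
  have rel: "int_relation I a y"
    unfolding y_def by (rule int_relation_linear[OF less.prems(1) x(1)])
  have y0: "y i0 = 0"
    using i0 by (auto simp: y_def T_def abs_if zero_less_mult_iff)
  have y_pos: "y i > 0" if "v i > 0" "x i \<le> 0" for i
  proof -
    have "\<bar>x i0\<bar> * v i > 0" "\<bar>v i0\<bar> * x i \<le> 0"
      using that nz by (simp_all add: mult_nonneg_nonpos)
    thus ?thesis by (simp add: y_def)
  qed
  have y_neg: "y i < 0" if "v i < 0" "x i \<ge> 0" for i
  proof -
    have "\<bar>x i0\<bar> * v i < 0" "\<bar>v i0\<bar> * x i \<ge> 0"
      using that nz by (simp_all add: mult_pos_neg)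
    thus ?thesis by (simp add: y_def)
  qed
  have y_nonneg: "y i \<ge> 0" if "v i > 0" for i
  proof (cases "x i > 0")
    case True
    thus ?thesis using cross[of i] that by (simp add: T_def y_def mult.commute)
  next
    case False
    thus ?thesis using y_pos[OF that] by simp
  qed
  have y_nonpos: "y i \<le> 0" if "v i < 0" for i
  proof (cases "x i < 0")
    case True
    hence "i \<in> T" using that by (simp add: T_def mult_neg_neg)
    thus ?thesis using cross[of i] that True by (simp add: y_def mult.commute)
  next
    case False
    thus ?thesis using y_neg[OF that] by simp
  qed
  have sub: "support y \<subseteq> support v - {i0}"
    using x(2) y0 by (auto simp: y_def support_def)
  moreover have "i0 \<in> support v" using nz by (simp add: support_def)
  ultimately have card: "card (support y) < card (support v)"
    using fin by (intro psubset_card_mono) auto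
  have step: ?case if "y i > 0" "w i = 0" for i
  proof -
    have "\<exists>i. y i < 0 \<and> w i = 0" by (rule less.hyps[OF card rel that])
    then obtain i' where i': "y i' < 0" "w i' = 0" by blast
    have "i' \<in> support v" using i'(1) sub by (force simp: support_def[of y])
    hence "v i' \<noteq> 0" by (simp add: support_def)
    hence "v i' < 0" using y_nonneg[of i'] i'(1) by linarith
    thus ?thesis using i'(2) by blast
  qed
  \<comment> \<open>If \<open>x j \<le> 0\<close>, then \<open>y\<close> stays positive at
    \<open>j\<close> and induction applies. Otherwise \<open>x\<close> has a zero of
    \<open>w\<close> at some negative coordinate \<open>i\<close>: either \<open>v i < 0\<close>,
    which is the goal, or \<open>v i > 0\<close> and \<open>y\<close> is positive at
    \<open>i\<close>.\<close>
  show ?case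
  proof (cases "x j \<le> 0")
    case True
    thus ?thesis using step y_pos less.prems by blast
  next
    case False
    then obtain i where i: "x i < 0" "w i = 0" using x(3) less.prems by force
    have "i \<in> support v" using i(1) x(2) by (force simp: support_def[of x])
    hence "v i \<noteq> 0" by (simp add: support_def)
    thus ?thesis using step[OF y_pos[of i]] i by (cases "v i < 0") auto
  qed
qed

text \<open>The difference \<open>v\<close> of the letter counts is a relation. If \<open>w\<close>
  vanishes on its support, it does so at coordinates of both signs, so both words contain a
  vanishing letter. Otherwise the Laurent monomial of \<open>v\<close> is 1 and turns one product
  into the other.\<close>

lemma word_prod_invariant:
  assumes circuit: "\<And>v. int_relation I a v \<Longrightarrow> support v \<noteq> {} \<Longrightarrow>
      \<exists>x. int_relation I a x \<and> support x \<noteq> {} \<and> support x \<subseteq> support v \<and>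
        Gcd (x ` support x) = 1 \<and>
        ((\<forall>j\<in>support x. w j \<noteq> 0) \<longrightarrow> laurent_monomial w x = 1) \<and>
        ((\<exists>j. x j > 0 \<and> w j = 0) \<longleftrightarrow> (\<exists>j. x j < 0 \<and> w j = 0))"
    and l: "set l \<subseteq> I" and l': "set l' \<subseteq> I"
    and eq: "sum_list (map a l) = sum_list (map a l')"
  shows "word_prod w l = word_prod w l'"
proof -
  define v where "v j = int (count_list l j) - int (count_list l' j)" for j
  define S where "S = set l \<union> set l'"
  have S: "finite S" "set l \<subseteq> S" "set l' \<subseteq> S" "support v \<subseteq> S" "S \<subseteq> I"
    using l l' by (auto simp: S_def support_def v_def intro: count_notin ccontr)
  have cl: "sum_list (map a m) = (\<Sum>j\<in>S. real (count_list m j) * a j)" if "set m \<subseteq> S" for m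
    using that
  proof (induction m)
    case (Cons i m)
    have "(\<Sum>j\<in>S. real (count_list (i # m) j) * a j) =
        (\<Sum>j\<in>S. (if j = i then a j else 0) + real (count_list m j) * a j)"
      by (intro sum.cong) (auto simp: algebra_simps)
    also have "\<dots> = a i + (\<Sum>j\<in>S. real (count_list m j) * a j)"
      using Cons.prems S(1) by (simp add: sum.distrib)
    finally show ?case using Cons by simp
  qed simp
  have rel: "int_relation I a v"
  proof (rule int_relationI[OF S(1,4)])
    show "support v \<subseteq> I" using S by blast
    show "(\<Sum>j\<in>S. of_int (v j) * a j) = 0"
      using eq cl[OF S(2)] cl[OF S(3)]
      by (simp add: v_def left_diff_distrib sum_subtractf)
  qed
  have zeros: "\<exists>x. int_relation I a x \<and> support x \<noteq> {} \<and> support x \<subseteq> support v \<and>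
      ((\<exists>j. x j > 0 \<and> w j = 0) \<longleftrightarrow> (\<exists>j. x j < 0 \<and> w j = 0))"
    if "int_relation I a v" "support v \<noteq> {}" for v
    using circuit[OF that] by blast
  have pos: "\<exists>j. v j < 0 \<and> w j = 0" if "v j > 0" "w j = 0" for j
    using zero_on_negative_part[where a = a and w = w and v = v and j = j, OF zeros rel that] .
  have neg: "\<exists>j. v j > 0 \<and> w j = 0" if "v j < 0" "w j = 0" for j
    using zero_on_negative_part[where a = a and w = w and v = "\<lambda>j. - v j" and j = j,
        OF zeros int_relation_uminus[OF rel]] that by simp
  show ?thesis
  proof (cases "\<exists>j\<in>support v. w j = 0")
    case True
    then obtain j i where "v j > 0" "w j = 0" "v i < 0" "w i = 0"
      using pos neg by (fastforce simp: support_def neq_iff)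
    hence "word_prod w l = 0" "word_prod w l' = 0"
      using word_prod_eq_0[of j l w] word_prod_eq_0[of i l' w] count_notin[of j l] count_notin[of i l']
      by (force simp: v_def)+
    thus ?thesis by simp
  next
    case False
    hence nz: "\<forall>j\<in>support v. w j \<noteq> 0" by blast
    have "laurent_monomial w v = 1"
      by (rule laurent_monomial_eq_1[OF _ rel nz]) (use circuit in blast)
    hence one: "(\<Prod>j\<in>S. w j powi v j) = 1"
      using laurent_monomial_eq[OF S(1,4)] by simp
    \<comment> \<open>Letters with \<open>v j = 0\<close> occur equally often in both words, so a
      factor that may be zero is never divided out.\<close>
    have "w j ^ count_list l j = w j powi v j * w j ^ count_list l' j" for j
    proof (cases "v j = 0")
      case False
      hence "w j \<noteq> 0" using nz by (simp add: support_def)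
      have "w j powi int (count_list l j) = w j powi (v j + int (count_list l' j))"
        by (simp add: v_def)
      also have "\<dots> = w j powi v j * w j powi int (count_list l' j)"
        using \<open>w j \<noteq> 0\<close> by (intro power_int_add) simp
      finally show ?thesis by simp
    qed (simp add: v_def)
    thus ?thesis
      using one by (simp add: word_prod_count_list[OF S(1,2)] word_prod_count_list[OF S(1,3)]
          prod.distrib)
  qed
qed

section \<open>Minimal dependent sets of frequencies\<close>

lemma common_denominator:
  fixes u :: "'i \<Rightarrow> rat"
  assumes "finite A"
  shows "\<exists>D::int. D > 0 \<and> (\<forall>x\<in>A. \<exists>m::int. of_int D * u x = of_int m)"
  using assms
proof (induction A rule: finite_induct)
  case empty
  show ?case by (intro exI[of _ 1]) auto
next
  case (insert x A)
  then obtain D :: int where D: "D > 0" "\<And>x. x \<in> A \<Longrightarrow> \<exists>m::int. of_int D * u x = of_int m"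
    by blast
  obtain p q where pq: "quotient_of (u x) = (p, q)" by (cases "quotient_of (u x)")
  have q: "q > 0" "u x = of_int p / of_int q"
    using quotient_of_denom_pos[OF pq] quotient_of_div[OF pq] by auto
  show ?case
  proof (rule exI[of _ "q * D"], intro conjI ballI)
    show "q * D > 0" using q D by simp
    fix y assume y: "y \<in> insert x A"
    show "\<exists>m::int. of_int (q * D) * u y = of_int m"
    proof (cases "y = x")
      case True
      have "of_int (q * D) * u y = of_int (D * p)" using q True by simp
      thus ?thesis by blast
    next
      case False
      then obtain m :: int where "of_int D * u y = of_int m" using D y by blast
      hence "of_int (q * D) * u y = of_int (q * m)" by (simp add: mult.assoc)
      thus ?thesis by blast
    qed
  qed
qed

text \<open>Clearing denominators makes rational coefficients integral. Dependence is stated for the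
  set of logarithms, so injectivity of \<open>j \<mapsto> ln (n j)\<close> is what carries it over
  to the indexed family.\<close>

lemma log_dependent_iff:
  assumes "inj_on n J" "\<And>j. j \<in> J \<Longrightarrow> n j \<ge> 2"
  shows "log_dependent n J \<longleftrightarrow>
    (\<exists>v. int_relation J (\<lambda>j. ln (real (n j))) v \<and> support v \<noteq> {})"
proof -
  interpret module "\<lambda>(q::rat) (x::real). of_rat q * x"
    by unfold_locales (auto simp: algebra_simps of_rat_add of_rat_mult)
  let ?a = "\<lambda>j. ln (real (n j))"
  have inj: "inj_on ?a J"
  proof (rule inj_onI)
    fix i j assume ij: "i \<in> J" "j \<in> J" "?a i = ?a j"
    have "n i > 0" "n j > 0" using assms(2)[OF ij(1)] assms(2)[OF ij(2)] by auto
    hence "n i = n j" using ij(3) by simp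
    thus "i = j" using assms(1) ij by (auto dest: inj_onD)
  qed
  show ?thesis
  proof
    assume "log_dependent n J"
    then obtain t u where t: "finite t" "t \<subseteq> ?a ` J" and sum0: "(\<Sum>r\<in>t. of_rat (u r) * r) = 0"
      and nz: "\<exists>r\<in>t. u r \<noteq> 0"
      unfolding log_dependent_def dependent_explicit by (elim exE conjE, intro that)
    obtain D :: int where D: "D > 0" "\<forall>r\<in>t. \<exists>m::int. of_int D * u r = of_int m"
      using common_denominator[OF t(1)] by blast
    then obtain m :: "real \<Rightarrow> int" where m: "\<And>r. r \<in> t \<Longrightarrow> of_int D * u r = of_int (m r)"
      by metis
    define S where "S = {j \<in> J. ?a j \<in> t}"
    define v where "v j = (if j \<in> S then m (?a j) else 0)" for j
    have injS: "inj_on ?a S" using inj by (rule inj_on_subset) (auto simp: S_def)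
    have img: "?a ` S = t" using t(2) by (auto simp: S_def)
    have finS: "finite S" using t(1) img injS finite_imageD by metis
    have mr: "of_int (m r) = of_int D * (of_rat (u r) :: real)" if "r \<in> t" for r
      using arg_cong[OF m[OF that], of "of_rat :: rat \<Rightarrow> real"] by (simp add: of_rat_mult)
    have "(\<Sum>j\<in>S. of_int (v j) * ?a j) = (\<Sum>j\<in>S. of_int (m (?a j)) * ?a j)"
      by (intro sum.cong) (auto simp: v_def)
    also have "\<dots> = (\<Sum>r\<in>t. of_int (m r) * r)"
      unfolding img[symmetric] by (simp add: sum.reindex[OF injS])
    also have "\<dots> = of_int D * (\<Sum>r\<in>t. of_rat (u r) * r)"
      by (simp add: mr sum_distrib_left mult.assoc)
    finally have "(\<Sum>j\<in>S. of_int (v j) * ?a j) = 0" using sum0 by simp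
    moreover have "support v \<subseteq> S" by (auto simp: support_def v_def)
    moreover have "S \<subseteq> J" by (auto simp: S_def)
    ultimately have "int_relation J ?a v" using finS by (intro int_relationI) auto
    moreover have "support v \<noteq> {}"
    proof -
      obtain r where r: "r \<in> t" "u r \<noteq> 0" using nz by blast
      then obtain j where j: "j \<in> S" "r = ?a j" using img by blast
      have "m r \<noteq> 0" using m[OF r(1)] r(2) D(1) by auto
      thus ?thesis using j by (auto simp: support_def v_def)
    qed
    ultimately show "\<exists>v. int_relation J ?a v \<and> support v \<noteq> {}" by blast
  next
    assume "\<exists>v. int_relation J ?a v \<and> support v \<noteq> {}"
    then obtain v where v: "int_relation J ?a v" "support v \<noteq> {}" by blast
    define S where "S = support v"
    have S: "finite S" "S \<subseteq> J" using v by (auto simp: S_def int_relation_def)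
    have injS: "inj_on ?a S" using inj S(2) by (rule inj_on_subset)
    define u :: "real \<Rightarrow> rat" where "u r = of_int (v (the_inv_into S ?a r))" for r
    have ua: "u (?a j) = of_int (v j)" if "j \<in> S" for j
      using that by (simp add: u_def the_inv_into_f_f[OF injS])
    have "(\<Sum>r\<in>?a ` S. of_rat (u r) * r) = (\<Sum>j\<in>S. of_rat (u (?a j)) * ?a j)"
      by (simp add: sum.reindex[OF injS])
    also have "\<dots> = (\<Sum>j\<in>S. of_int (v j) * ?a j)"
      by (intro sum.cong) (auto simp: ua)
    also have "\<dots> = 0" using v by (simp add: S_def int_relation_def)
    finally have "(\<Sum>r\<in>?a ` S. of_rat (u r) * r) = 0" .
    moreover have "\<exists>r\<in>?a ` S. u r \<noteq> 0"
    proof -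
      obtain j where "j \<in> S" using v(2) S_def by blast
      thus ?thesis using ua[of j] by (auto simp: S_def support_def)
    qed
    moreover have "finite (?a ` S)" "?a ` S \<subseteq> ?a ` J" using S by auto
    ultimately show "log_dependent n J"
      unfolding log_dependent_def dependent_explicit by (intro exI[of _ "?a ` S"] exI[of _ u] conjI)
  qed
qed

section \<open>Integer exponents of a minimal relation\<close>

lemma ln_prod_power:
  fixes n :: "'i \<Rightarrow> nat"
  assumes "\<And>i. i \<in> A \<Longrightarrow> n i \<ge> 2"
  shows "ln (real (\<Prod>i\<in>A. n i ^ \<beta> i)) = (\<Sum>i\<in>A. real (\<beta> i) * ln (real (n i)))"
  using assms
proof (induction A rule: infinite_finite_induct)
  case (insert i A)
  have "n i > 0" "(\<Prod>i\<in>A. n i ^ \<beta> i) > 0"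
    using insert.prems by (auto intro!: prod_pos simp: order_less_le_trans[of 0 2])
  hence "ln (real (n i ^ \<beta> i * (\<Prod>i\<in>A. n i ^ \<beta> i))) =
      ln (real (n i ^ \<beta> i)) + ln (real (\<Prod>i\<in>A. n i ^ \<beta> i))"
    unfolding of_nat_mult by (subst ln_mult) (auto simp del: of_nat_prod)
  thus ?case using insert by (simp add: ln_realpow del: of_nat_prod)
qed simp_all

lemma Gcd_nat_abs_div:
  fixes v :: "'i \<Rightarrow> int"
  assumes "g = Gcd ((\<lambda>j. nat \<bar>v j\<bar>) ` J)" "g \<noteq> 0"
  shows "Gcd ((\<lambda>j. nat \<bar>v j\<bar> div g) ` J) = 1"
proof -
  define e where "e = Gcd ((\<lambda>j. nat \<bar>v j\<bar> div g) ` J)"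
  have "e * g dvd nat \<bar>v j\<bar>" if "j \<in> J" for j
  proof -
    have "e dvd nat \<bar>v j\<bar> div g" using that unfolding e_def by (intro Gcd_dvd) auto
    moreover have "g dvd nat \<bar>v j\<bar>" using that unfolding assms(1) by (intro Gcd_dvd) auto
    ultimately show ?thesis using assms(2) by (simp add: dvd_div_iff_mult)
  qed
  hence "e * g dvd g" unfolding assms(1) by (intro Gcd_greatest) auto
  thus ?thesis using assms(2) by (simp add: e_def)
qed

text \<open>The support of a nontrivial relation on \<open>J\<close> is finite and itself dependent,
  so minimality makes it all of \<open>J\<close>.\<close>

lemma minimal_dependent_finite:
  assumes "weight_frequency_data d b n" "J \<in> minimal_dependent d n"
  obtains v where "int_relation J (\<lambda>j. ln (real (n j))) v" "support v = J" "J \<noteq> {}" "finite J"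
proof -
  have n: "inj_on n (idx d)" "\<And>j. j \<in> idx d \<Longrightarrow> n j \<ge> 2"
    using assms(1) by (auto simp: weight_frequency_data_def)
  have J: "J \<subseteq> idx d" "log_dependent n J" "\<And>J'. J' \<subset> J \<Longrightarrow> \<not> log_dependent n J'"
    using assms(2) by (auto simp: minimal_dependent_def)
  have iff: "log_dependent n K \<longleftrightarrow> (\<exists>v. int_relation K (\<lambda>j. ln (real (n j))) v \<and> support v \<noteq> {})"
    if "K \<subseteq> idx d" for K
    using that n by (intro log_dependent_iff) (auto intro: inj_on_subset)
  obtain v where v: "int_relation J (\<lambda>j. ln (real (n j))) v" "support v \<noteq> {}"
    using iff[OF J(1)] J(2) by blast
  have sub: "support v \<subseteq> J" using v(1) by (simp add: int_relation_def)
  have "int_relation (support v) (\<lambda>j. ln (real (n j))) v"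
    using v(1) by (simp add: int_relation_def)
  hence "log_dependent n (support v)" using iff[of "support v"] sub J(1) v(2) by blast
  hence "support v = J" using J(3) sub by blast
  thus ?thesis using that v by (auto simp: int_relation_def)
qed

text \<open>A relation supported on all of \<open>J\<close> is split by sign and divided by its gcd.
  Neither part is empty, because all logarithms are positive and a nonempty positive sum is not
  zero.\<close>

lemma relation_data_exists:
  assumes data: "weight_frequency_data d b n" and J: "J \<in> minimal_dependent d n"
  shows "\<exists>r. relation_data n J r"
proof -
  let ?a = "\<lambda>j. ln (real (n j))"
  obtain v where v: "int_relation J ?a v" "support v = J" "J \<noteq> {}" "finite J"
    by (rule minimal_dependent_finite[OF data J])
  have n2: "n j \<ge> 2" if "j \<in> J" for j
    using data J that by (auto simp: weight_frequency_data_def minimal_dependent_def)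
  have a_pos: "?a j > 0" if "j \<in> J" for j using n2[OF that] by simp
  have v0: "v j \<noteq> 0" if "j \<in> J" for j using that v(2) by (auto simp: support_def)
  define g where "g = Gcd ((\<lambda>j. nat \<bar>v j\<bar>) ` J)"
  have g0: "g \<noteq> 0" using v(3) v0 by (auto simp: g_def)
  define \<beta> where "\<beta> j = nat \<bar>v j\<bar> div g" for j
  have g\<beta>: "nat \<bar>v j\<bar> = g * \<beta> j" if "j \<in> J" for j
    using that unfolding \<beta>_def g_def by (intro dvd_mult_div_cancel[symmetric] Gcd_dvd) auto
  have vg: "real_of_int \<bar>v j\<bar> = real g * real (\<beta> j)" if "j \<in> J" for j
    using arg_cong[OF g\<beta>[OF that], of real] by simp
  have \<beta>1: "\<beta> j \<ge> 1" if "j \<in> J" for j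
    using g\<beta>[OF that] v0[OF that] by (cases "\<beta> j") auto
  define J1 where "J1 = {j \<in> J. v j > 0}"
  define J2 where "J2 = {j \<in> J. v j < 0}"
  have un: "J1 \<union> J2 = J" "J1 \<inter> J2 = {}" using v0 by (auto simp: J1_def J2_def neq_iff)
  have fin: "finite J1" "finite J2" using v(4) by (auto simp: J1_def J2_def)
  have "0 = (\<Sum>j\<in>J. of_int (v j) * ?a j)" using v by (simp add: int_relation_def)
  also have "\<dots> = (\<Sum>j\<in>J1. of_int (v j) * ?a j) + (\<Sum>j\<in>J2. of_int (v j) * ?a j)"
    by (subst un(1)[symmetric], rule sum.union_disjoint) (use un(2) fin in auto)
  also have "(\<Sum>j\<in>J1. of_int (v j) * ?a j) = (\<Sum>j\<in>J1. real g * (real (\<beta> j) * ?a j))"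
  proof (intro sum.cong refl)
    fix j assume "j \<in> J1"
    hence "real_of_int (v j) = real g * real (\<beta> j)" using vg[of j] by (simp add: J1_def)
    thus "of_int (v j) * ?a j = real g * (real (\<beta> j) * ?a j)" by simp
  qed
  also have "(\<Sum>j\<in>J2. of_int (v j) * ?a j) = (\<Sum>j\<in>J2. - (real g * (real (\<beta> j) * ?a j)))"
  proof (intro sum.cong refl)
    fix j assume "j \<in> J2"
    hence "real_of_int (v j) = - (real g * real (\<beta> j))" using vg[of j] by (simp add: J2_def)
    thus "of_int (v j) * ?a j = - (real g * (real (\<beta> j) * ?a j))" by simp
  qed
  finally have "real g * (\<Sum>j\<in>J1. real (\<beta> j) * ?a j) = real g * (\<Sum>j\<in>J2. real (\<beta> j) * ?a j)"
    by (simp add: sum_negf sum_distrib_left)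
  hence eq: "(\<Sum>j\<in>J1. real (\<beta> j) * ?a j) = (\<Sum>j\<in>J2. real (\<beta> j) * ?a j)"
    using g0 by simp
  have pos: "(\<Sum>j\<in>K. real (\<beta> j) * ?a j) > 0" if "K \<subseteq> J" "K \<noteq> {}" for K
  proof (rule sum_pos)
    show "finite K" "K \<noteq> {}" using that v(4) finite_subset by auto
    fix j assume "j \<in> K"
    hence "j \<in> J" using that by blast
    thus "real (\<beta> j) * ?a j > 0" using \<beta>1[of j] a_pos[of j] by (intro mult_pos_pos) auto
  qed
  have "J1 \<noteq> {}"
  proof
    assume 1: "J1 = {}"
    hence "J2 = J" using un(1) by simp
    thus False using pos[of J2] v(3) eq 1 by simp
  qed
  moreover have "J2 \<noteq> {}"
  proof
    assume 2: "J2 = {}"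
    hence "J1 = J" using un(1) by simp
    thus False using pos[of J1] v(3) eq 2 by simp
  qed
  moreover have "Gcd (\<beta> ` J) = 1"
    unfolding \<beta>_def using Gcd_nat_abs_div[OF g_def g0] .
  moreover have "(\<Prod>i\<in>J1. n i ^ \<beta> i) = (\<Prod>i\<in>J2. n i ^ \<beta> i)"
  proof -
    have "ln (real (\<Prod>i\<in>J1. n i ^ \<beta> i)) = ln (real (\<Prod>i\<in>J2. n i ^ \<beta> i))"
      using eq n2 un by (subst (1 2) ln_prod_power) auto
    moreover have "(\<Prod>i\<in>J1. n i ^ \<beta> i) > 0" "(\<Prod>i\<in>J2. n i ^ \<beta> i) > 0"
      using n2 un by (auto intro!: prod_pos simp: order_less_le_trans[of 0 2] J1_def J2_def)
    ultimately show ?thesis by (simp del: of_nat_prod)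
  qed
  ultimately have "relation_data n J (J1, J2, \<beta>)"
    unfolding relation_data_def using un \<beta>1 by auto
  thus ?thesis by blast
qed

text \<open>Removing the factors \<open>sqrt (b j)\<close> from the coordinates gives both terms of
  \<open>q_J\<close> the same weight, the product over all of \<open>J\<close>, leaving a pure
  binomial. The relation data are those picked by \<open>SOME\<close>, so no uniqueness argument
  enters.\<close>

lemma q_poly_scaled:
  assumes data: "weight_frequency_data d b n" and J: "J \<in> minimal_dependent d n"
  obtains J1 J2 \<beta> c where "relation_data n J (J1, J2, \<beta>)" "c \<noteq> 0"
    "\<And>z w. (\<And>j. j \<in> J \<Longrightarrow> z j = of_real (sqrt (b j)) * w j) \<Longrightarrow>
      q_poly b n J z = c * ((\<Prod>i\<in>J2. w i ^ \<beta> i) - (\<Prod>i\<in>J1. w i ^ \<beta> i))"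
proof -
  define r where "r = (SOME r. relation_data n J r)"
  have r: "relation_data n J r"
    unfolding r_def using relation_data_exists[OF data J] by (rule someI_ex)
  obtain J1 J2 \<beta> where r_eq: "r = (J1, J2, \<beta>)" by (cases r)
  have un: "J1 \<union> J2 = J" using r by (simp add: r_eq relation_data_def)
  have b: "b j > 0" if "j \<in> J" for j
    using data J that by (auto simp: weight_frequency_data_def minimal_dependent_def)
  define e where "e K = complex_of_real (\<Prod>i\<in>K. b i powr (real (\<beta> i) / 2))" for K
  have e: "e K = (\<Prod>i\<in>K. of_real (sqrt (b i)) ^ \<beta> i)" if "K \<subseteq> J" for K
    unfolding e_def of_real_prod
  proof (intro prod.cong refl)
    fix i assume "i \<in> K"
    hence "b i > 0" using b that by blast
    hence "b i powr (real (\<beta> i) / 2) = sqrt (b i) ^ \<beta> i"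
      by (simp add: powr_half_sqrt[symmetric] powr_powr flip: powr_realpow)
    thus "complex_of_real (b i powr (real (\<beta> i) / 2)) = of_real (sqrt (b i)) ^ \<beta> i" by simp
  qed
  have enz: "e K \<noteq> 0" if "K \<subseteq> J" for K
    unfolding e_def using b that
    by (cases "finite K") (fastforce simp: of_real_eq_0_iff simp del: of_real_prod)+
  have q: "q_poly b n J z = e J1 * (\<Prod>i\<in>J2. z i ^ \<beta> i) - e J2 * (\<Prod>i\<in>J1. z i ^ \<beta> i)" for z
    unfolding q_poly_def r_def[symmetric] r_eq e_def by simp
  have "q_poly b n J z = e J1 * e J2 * ((\<Prod>i\<in>J2. w i ^ \<beta> i) - (\<Prod>i\<in>J1. w i ^ \<beta> i))"
    if "\<And>j. j \<in> J \<Longrightarrow> z j = of_real (sqrt (b j)) * w j" for z w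
  proof -
    have "(\<Prod>i\<in>K. z i ^ \<beta> i) = e K * (\<Prod>i\<in>K. w i ^ \<beta> i)" if K: "K \<subseteq> J" for K
    proof -
      have "(\<Prod>i\<in>K. z i ^ \<beta> i) = (\<Prod>i\<in>K. of_real (sqrt (b i)) ^ \<beta> i * w i ^ \<beta> i)"
        by (intro prod.cong refl) (use \<open>\<And>j. j \<in> J \<Longrightarrow> z j = _\<close> K in \<open>auto simp: power_mult_distrib\<close>)
      thus ?thesis by (simp add: e[OF K] prod.distrib)
    qed
    thus ?thesis using un unfolding q by (auto simp: algebra_simps)
  qed
  moreover have "e J1 * e J2 \<noteq> 0" using enz un by auto
  ultimately show ?thesis using that r r_eq by blast
qed

text \<open>Taking \<open>x\<close> to be \<open>\<beta>\<close> on \<open>J1\<close> and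
  \<open>- \<beta>\<close> on \<open>J2\<close> turns the binomial equation into the two facts the
  lattice argument consumes: a Laurent monomial equal to 1 away from zeros, and in general a
  vanishing factor on one side exactly when there is one on the other.\<close>

lemma circuit_of_relation_data:
  fixes w :: "nat \<Rightarrow> complex"
  assumes data: "weight_frequency_data d b n" and J: "J \<in> minimal_dependent d n"
    and r: "relation_data n J (J1, J2, \<beta>)"
    and w: "(\<Prod>i\<in>J2. w i ^ \<beta> i) = (\<Prod>i\<in>J1. w i ^ \<beta> i)"
  shows "\<exists>x. int_relation (idx d) (\<lambda>j. ln (real (n j))) x \<and> support x = J \<and>
    Gcd (x ` J) = 1 \<and> ((\<forall>j\<in>J. w j \<noteq> 0) \<longrightarrow> laurent_monomial w x = 1) \<and>
    ((\<exists>j. x j > 0 \<and> w j = 0) \<longleftrightarrow> (\<exists>j. x j < 0 \<and> w j = 0))"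
proof -
  let ?a = "\<lambda>j. ln (real (n j))"
  have fin: "finite J" by (rule minimal_dependent_finite[OF data J])
  have sub: "J \<subseteq> idx d" using J by (auto simp: minimal_dependent_def)
  have n2: "n j \<ge> 2" if "j \<in> J" for j
    using data sub that by (auto simp: weight_frequency_data_def)
  have rel: "J1 \<union> J2 = J" "J1 \<inter> J2 = {}" "\<And>j. j \<in> J \<Longrightarrow> \<beta> j \<ge> 1" "Gcd (\<beta> ` J) = 1"
    "(\<Prod>i\<in>J1. n i ^ \<beta> i) = (\<Prod>i\<in>J2. n i ^ \<beta> i)"
    using r by (auto simp: relation_data_def)
  have fin12: "finite J1" "finite J2" using fin rel(1) by auto
  define x where "x j = (if j \<in> J1 then int (\<beta> j) else if j \<in> J2 then - int (\<beta> j) else 0)" for j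
  have x1: "x j = int (\<beta> j)" if "j \<in> J1" for j using that by (simp add: x_def)
  have x2: "x j = - int (\<beta> j)" if "j \<in> J2" for j using that rel(2) by (auto simp: x_def)
  have x_pos: "x j > 0 \<longleftrightarrow> j \<in> J1" for j using rel by (auto simp: x_def Suc_le_eq)
  have x_neg: "x j < 0 \<longleftrightarrow> j \<in> J2" for j
    using rel(1-3) by (auto simp: x_def Suc_le_eq)
  have supp: "support x = J"
    unfolding support_def rel(1)[symmetric] using x_pos x_neg by (auto simp: neq_iff)
  have split: "(\<Sum>j\<in>J. f j) = (\<Sum>j\<in>J1. f j) + (\<Sum>j\<in>J2. f j)" for f :: "nat \<Rightarrow> real"
    by (subst rel(1)[symmetric], rule sum.union_disjoint) (use rel(2) fin12 in auto)
  have "(\<Sum>j\<in>J. of_int (x j) * ?a j) =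
      (\<Sum>j\<in>J1. real (\<beta> j) * ?a j) - (\<Sum>j\<in>J2. real (\<beta> j) * ?a j)"
    unfolding split by (simp add: x1 x2 sum_negf)
  also have "\<dots> = ln (real (\<Prod>i\<in>J1. n i ^ \<beta> i)) - ln (real (\<Prod>i\<in>J2. n i ^ \<beta> i))"
    using n2 rel(1) by (subst (1 2) ln_prod_power) auto
  finally have "(\<Sum>j\<in>J. of_int (x j) * ?a j) = 0" using rel(5) by simp
  hence int: "int_relation (idx d) ?a x"
    using fin sub supp by (intro int_relationI[of J]) auto
  have gcd: "Gcd (x ` J) = 1"
  proof -
    define e where "e = Gcd (x ` J)"
    have e0: "e \<ge> 0" by (simp add: e_def)
    have "nat e dvd \<beta> j" if "j \<in> J" for j
    proof -
      have "e dvd x j" unfolding e_def using that by (intro Gcd_dvd) auto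
      hence "e dvd int (\<beta> j)" using that rel(1) x1 x2 by fastforce
      thus ?thesis using e0 by (metis int_dvd_int_iff int_nat_eq)
    qed
    hence "nat e dvd Gcd (\<beta> ` J)" by (intro Gcd_greatest) auto
    hence "nat e = 1" using rel(4) by simp
    thus ?thesis unfolding e_def[symmetric] by simp
  qed
  have "laurent_monomial w x = 1" if nz: "\<forall>j\<in>J. w j \<noteq> 0"
  proof -
    have "laurent_monomial w x = (\<Prod>j\<in>J1. w j powi x j) * (\<Prod>j\<in>J2. w j powi x j)"
      unfolding laurent_monomial_def supp
      by (subst rel(1)[symmetric], rule prod.union_disjoint) (use rel(2) fin12 in auto)
    also have "(\<Prod>j\<in>J1. w j powi x j) = (\<Prod>j\<in>J1. w j ^ \<beta> j)"
      by (simp add: x1)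
    also have "(\<Prod>j\<in>J2. w j powi x j) = inverse (\<Prod>j\<in>J2. w j ^ \<beta> j)"
      by (simp add: x2 power_int_minus prod_inversef[symmetric])
    also have "(\<Prod>j\<in>J1. w j ^ \<beta> j) * inverse (\<Prod>j\<in>J2. w j ^ \<beta> j) = 1"
      unfolding w[symmetric] using nz rel(1) fin12 by (intro right_inverse) auto
    finally show ?thesis .
  qed
  moreover have "(\<exists>j. x j > 0 \<and> w j = 0) \<longleftrightarrow> (\<exists>j. x j < 0 \<and> w j = 0)"
  proof -
    have "(\<exists>j\<in>K. w j = 0) \<longleftrightarrow> (\<Prod>i\<in>K. w i ^ \<beta> i) = 0" if "K \<subseteq> J" for K
      using that fin rel(3) by (auto simp: finite_subset prod_zero_iff Suc_le_eq)
    from this[of J1] this[of J2] show ?thesis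
      using w rel(1) by (auto simp: x_pos x_neg)
  qed
  ultimately show ?thesis using int supp gcd by blast
qed

section \<open>Dirichlet series and the multiplier variety\<close>

text \<open>\<open>B\<close> holds the coefficients of a Dirichlet series shifted so that it converges at \<open>0\<close>, where
  unordered convergence is absolute; testing at \<open>s = 0, 1, 2, \<dots>\<close> is enough.\<close>

lemma dirichlet_coeffs_eq_0:
  fixes B :: "nat \<Rightarrow> complex"
  assumes zero: "\<And>k. ((\<lambda>N. B N / of_nat N ^ k) has_sum 0) {1..}"
    and "N \<ge> 1"
  shows "B N = 0"
  using assms(2)
proof (induction N rule: less_induct)
  case (less N)
  have "B summable_on {1..}" using has_sum_imp_summable[OF zero[of 0]] by simp
  hence abs: "(\<lambda>M. cmod (B M)) summable_on {1..}"
    by (simp add: summable_on_iff_abs_summable_on_complex)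
  have abs': "(\<lambda>M. cmod (B M)) summable_on {N<..}"
    by (rule summable_on_subset_banach[OF abs]) auto
  define S where "S = (\<Sum>\<^sub>\<infinity>M\<in>{N<..}. cmod (B M))"
  have S: "((\<lambda>M. cmod (B M)) has_sum S) {N<..}" using abs' by (simp add: S_def)
  \<comment> \<open>Coefficients below \<open>N\<close> vanish by induction, so the
    \<open>N\<close>-th term is minus the tail; there every index is at least \<open>N + 1\<close>,
    which makes the ratio less than 1.\<close>
  have bound: "cmod (B N) \<le> S * (real N / real (Suc N)) ^ k" for k
  proof -
    have ins: "{N..} = insert N {N<..}" by auto
    have "((\<lambda>M. B M / of_nat M ^ k) has_sum 0) {N..}"
    proof -
      have "((\<lambda>M. B M / of_nat M ^ k) has_sum 0) {1..} \<longleftrightarrow>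
          ((\<lambda>M. B M / of_nat M ^ k) has_sum 0) {N..}"
        by (rule has_sum_cong_neutral) (use less in auto)
      thus ?thesis using zero by simp
    qed
    hence 0: "((\<lambda>M. B M / of_nat M ^ k) has_sum 0) (insert N {N<..})"
      by (simp only: ins)
    hence "(\<lambda>M. B M / of_nat M ^ k) summable_on {N<..}"
      by (intro summable_on_subset_banach[OF has_sum_imp_summable[OF 0]]) auto
    then obtain T where T: "((\<lambda>M. B M / of_nat M ^ k) has_sum T) {N<..}"
      by (auto simp: summable_on_def)
    have "B N / of_nat N ^ k + T = 0"
      by (rule has_sum_unique[OF has_sum_insert[OF _ T] 0]) simp
    hence "B N / of_nat N ^ k = - T" by (rule eq_neg_iff_add_eq_0[THEN iffD2])
    hence "cmod (B N / of_nat N ^ k) = cmod T" by (simp only: norm_minus_cancel)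
    also have "cmod T \<le> S / real (Suc N) ^ k"
    proof (rule norm_infsum_le)
      show "((\<lambda>M. B M / of_nat M ^ k) has_sum T) {N<..}" by (rule T)
      show "((\<lambda>M. cmod (B M) / real (Suc N) ^ k) has_sum S / real (Suc N) ^ k) {N<..}"
        by (intro has_sum_divide_const S)
      fix M assume "M \<in> {N<..}"
      hence "real (Suc N) ^ k \<le> real M ^ k" by (intro power_mono) auto
      thus "cmod (B M / of_nat M ^ k) \<le> cmod (B M) / real (Suc N) ^ k"
        by (simp add: norm_divide norm_power frac_le)
    qed
    finally have "cmod (B N) / real N ^ k \<le> S / real (Suc N) ^ k"
      by (simp add: norm_divide norm_power)
    thus ?thesis using less.prems by (simp add: power_divide divide_le_eq)
  qed
  have "(\<lambda>k. S * (real N / real (Suc N)) ^ k) \<longlonglongrightarrow> S * 0"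
    by (intro tendsto_mult tendsto_const LIMSEQ_realpow_zero) auto
  hence "cmod (B N) \<le> S * 0"
    by (rule LIMSEQ_le_const) (use bound in auto)
  thus ?case by simp
qed

section \<open>Image of the Dirichlet map and the two inclusions\<close>

lemma dirichlet_map_in_ball:
  assumes data: "weight_frequency_data d b n" and "admissible d b n \<rho>" "s \<in> half_plane \<rho>"
  shows "dirichlet_map d b n s \<in> Cd_ball d"
proof -
  have eq: "(cmod (dirichlet_map d b n s j))\<^sup>2 = b j * real (n j) powr (- 2 * Re s)"
    if "j \<in> idx d" for j
  proof -
    have "b j > 0" "n j \<ge> 2" using data that by (auto simp: weight_frequency_data_def)
    moreover have "cmod (of_nat (n j) powr (- s)) = real (n j) powr (- Re s)"
      using norm_powr_real_powr[of "of_nat (n j)" "- s"] by simp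
    ultimately show ?thesis using that
      by (simp add: dirichlet_map_def norm_mult power_mult_distrib powr_power mult.commute)
  qed
  have "(\<lambda>j. (cmod (dirichlet_map d b n s j))\<^sup>2) summable_on idx d \<longleftrightarrow>
      (\<lambda>j. b j * real (n j) powr (- 2 * Re s)) summable_on idx d"
    by (rule summable_on_cong) (rule eq)
  moreover have "(\<Sum>\<^sub>\<infinity>j\<in>idx d. (cmod (dirichlet_map d b n s j))\<^sup>2) =
      (\<Sum>\<^sub>\<infinity>j\<in>idx d. b j * real (n j) powr (- 2 * Re s))"
    by (rule infsum_cong) (rule eq)
  ultimately show ?thesis
    using assms(2,3) by (simp add: Cd_ball_def Cd_def admissible_def dirichlet_map_def)
qed

text \<open>After rescaling, the coordinates are \<open>n j powr (- s)\<close>, and each side of the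
  binomial is the same integer raised to \<open>- s\<close>. Real logarithms of positive integers
  avoid any choice of branch.\<close>

lemma q_poly_dirichlet_map:
  assumes data: "weight_frequency_data d b n" and J: "J \<in> minimal_dependent d n"
  shows "q_poly b n J (dirichlet_map d b n s) = 0"
proof -
  obtain J1 J2 \<beta> c where r: "relation_data n J (J1, J2, \<beta>)" and q:
    "\<And>z w. (\<And>j. j \<in> J \<Longrightarrow> z j = of_real (sqrt (b j)) * w j) \<Longrightarrow>
      q_poly b n J z = c * ((\<Prod>i\<in>J2. w i ^ \<beta> i) - (\<Prod>i\<in>J1. w i ^ \<beta> i))"
    by (rule q_poly_scaled[OF data J]) blast
  have sub: "J \<subseteq> idx d" using J by (auto simp: minimal_dependent_def)
  have n2: "n j \<ge> 2" if "j \<in> J" for j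
    using data sub that by (auto simp: weight_frequency_data_def)
  have fin: "finite J" by (rule minimal_dependent_finite[OF data J])
  have prod: "(\<Prod>i\<in>K. (of_nat (n i) powr (- s)) ^ \<beta> i) =
      exp (- s * of_real (ln (real (\<Prod>i\<in>K. n i ^ \<beta> i))))" if K: "K \<subseteq> J" for K
  proof -
    have "(\<Prod>i\<in>K. (of_nat (n i) powr (- s)) ^ \<beta> i) =
        (\<Prod>i\<in>K. exp (of_nat (\<beta> i) * (- s * of_real (ln (real (n i))))))"
    proof (intro prod.cong refl)
      fix i assume "i \<in> K"
      hence "n i > 0" using n2[of i] K by auto
      moreover from this have "Ln (of_nat (n i)) = complex_of_real (ln (real (n i)))"
        using Ln_of_real[of "real (n i)"] by simp
      ultimately show "(of_nat (n i) powr (- s)) ^ \<beta> i =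
          exp (of_nat (\<beta> i) * (- s * of_real (ln (real (n i)))))"
        unfolding exp_of_nat_mult powr_def by simp
    qed
    also have "\<dots> = exp (\<Sum>i\<in>K. of_nat (\<beta> i) * (- s * of_real (ln (real (n i)))))"
      using fin K by (simp add: exp_sum finite_subset)
    also have "(\<Sum>i\<in>K. of_nat (\<beta> i) * (- s * of_real (ln (real (n i))))) =
        - s * of_real (\<Sum>i\<in>K. real (\<beta> i) * ln (real (n i)))"
      by (simp add: sum_distrib_left mult_ac sum_negf)
    also have "(\<Sum>i\<in>K. real (\<beta> i) * ln (real (n i))) = ln (real (\<Prod>i\<in>K. n i ^ \<beta> i))"
      using n2 K by (intro ln_prod_power[symmetric]) auto
    finally show ?thesis .
  qed
  have "q_poly b n J (dirichlet_map d b n s) =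
      c * ((\<Prod>i\<in>J2. (of_nat (n i) powr (- s)) ^ \<beta> i) - (\<Prod>i\<in>J1. (of_nat (n i) powr (- s)) ^ \<beta> i))"
    by (rule q) (use sub in \<open>auto simp: dirichlet_map_def\<close>)
  also have "\<dots> = 0"
    using r prod[of J1] prod[of J2] by (auto simp: relation_data_def simp del: of_nat_prod)
  finally show ?thesis .
qed

lemma (in drury_arveson) q_poly_multiplier:
  assumes data: "weight_frequency_data d b n" and J: "J \<in> minimal_dependent d n"
  shows "on_ball (q_poly b n J) \<in> multipliers"
proof -
  obtain J1 J2 \<beta> where r: "(SOME r. relation_data n J r) = (J1, J2, \<beta>)"
    by (cases "SOME r. relation_data n J r")
  have "relation_data n J (J1, J2, \<beta>)"
    using someI_ex[OF relation_data_exists[OF data J]] r by simp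
  moreover have "finite J" by (rule minimal_dependent_finite[OF data J])
  ultimately have fin: "finite J1" "finite J2" by (auto simp: relation_data_def)
  have "q_poly b n J = (\<lambda>z.
      of_real (\<Prod>i\<in>J1. b i powr (real (\<beta> i) / 2)) * (\<Prod>i\<in>J2. z i ^ \<beta> i) -
      of_real (\<Prod>i\<in>J2. b i powr (real (\<beta> i) / 2)) * (\<Prod>i\<in>J1. z i ^ \<beta> i))"
    by (simp add: q_poly_def r fun_eq_iff)
  thus ?thesis
    by (simp only:) (intro diff_multiplier mult_multiplier const_multiplier prod_multiplier
        power_multiplier coordinate_multiplier fin)
qed

text \<open>Words of equal value have equal sums of logarithms. Every nontrivial relation has finite
  dependent support, which contains a minimal dependent \<open>J\<close>, and
  \<open>q_J z = 0\<close> makes the relation of \<open>J\<close> satisfy the circuit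
  condition.\<close>

lemma word_prod_eq_if_q_poly_zero:
  assumes data: "weight_frequency_data d b n" and z: "z \<in> Cd_ball d"
    and q: "\<And>J. J \<in> minimal_dependent d n \<Longrightarrow> q_poly b n J z = 0"
    and l: "set l \<subseteq> idx d" "set l' \<subseteq> idx d" and eq: "word_prod n l = word_prod n l'"
  shows "word_prod (\<lambda>j. z j / of_real (sqrt (b j))) l = word_prod (\<lambda>j. z j / of_real (sqrt (b j))) l'"
proof (rule word_prod_invariant)
  define w where "w = (\<lambda>j. z j / of_real (sqrt (b j)))"
  let ?a = "\<lambda>j. ln (real (n j))"
  have n: "inj_on n (idx d)" "\<And>j. j \<in> idx d \<Longrightarrow> n j \<ge> 2" "\<And>j. j \<in> idx d \<Longrightarrow> b j > 0"
    using data by (auto simp: weight_frequency_data_def)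
  show "set l \<subseteq> idx d" "set l' \<subseteq> idx d" by (fact l)+
  have ln: "word_prod n l > 0 \<and> sum_list (map ?a l) = ln (real (word_prod n l))"
    if "set l \<subseteq> idx d" for l
    using that
  proof (induction l)
    case (Cons j l)
    hence "n j \<ge> 2" "word_prod n l > 0" using n(2) by auto
    thus ?case using Cons by (simp add: ln_mult)
  qed simp
  show "sum_list (map ?a l) = sum_list (map ?a l')" using ln[OF l(1)] ln[OF l(2)] eq by simp
  fix v assume v: "int_relation (idx d) ?a v" "support v \<noteq> {}"
  have fin: "finite (support v)" and sub: "support v \<subseteq> idx d"
    using v(1) by (auto simp: int_relation_def)
  have "int_relation (support v) ?a v" using v(1) by (simp add: int_relation_def)
  hence "log_dependent n (support v)"
    using v(2) sub n(1,2) by (subst log_dependent_iff) (auto intro: inj_on_subset)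
  hence "{K \<in> Pow (support v). log_dependent n K} \<noteq> {}" by blast
  then obtain J where J: "J \<subseteq> support v" "log_dependent n J"
    and min: "\<And>K. K \<subseteq> support v \<Longrightarrow> log_dependent n K \<Longrightarrow> K \<subseteq> J \<Longrightarrow> J = K"
    using finite_has_minimal[of "{K \<in> Pow (support v). log_dependent n K}"] fin by auto
  have Jmin: "J \<in> minimal_dependent d n"
    unfolding minimal_dependent_def using J min sub by blast
  obtain J1 J2 \<beta> c where r: "relation_data n J (J1, J2, \<beta>)" and c: "c \<noteq> 0" and qq:
    "\<And>z w. (\<And>j. j \<in> J \<Longrightarrow> z j = of_real (sqrt (b j)) * w j) \<Longrightarrow>
      q_poly b n J z = c * ((\<Prod>i\<in>J2. w i ^ \<beta> i) - (\<Prod>i\<in>J1. w i ^ \<beta> i))"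
    by (rule q_poly_scaled[OF data Jmin]) blast
  have "q_poly b n J z = c * ((\<Prod>i\<in>J2. w i ^ \<beta> i) - (\<Prod>i\<in>J1. w i ^ \<beta> i))"
  proof (rule qq)
    fix j assume "j \<in> J"
    hence "b j > 0" using n(3) J sub by blast
    thus "z j = of_real (sqrt (b j)) * w j" by (simp add: w_def)
  qed
  hence "(\<Prod>i\<in>J2. w i ^ \<beta> i) = (\<Prod>i\<in>J1. w i ^ \<beta> i)" using q[OF Jmin] c by simp
  from circuit_of_relation_data[OF data Jmin r this]
  obtain x where x: "int_relation (idx d) ?a x" "support x = J" "Gcd (x ` J) = 1"
    "(\<forall>j\<in>J. w j \<noteq> 0) \<longrightarrow> laurent_monomial w x = 1"
    "(\<exists>j. x j > 0 \<and> w j = 0) \<longleftrightarrow> (\<exists>j. x j < 0 \<and> w j = 0)"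
    by blast
  have "J \<noteq> {}" by (rule minimal_dependent_finite[OF data Jmin])
  have "\<exists>x. int_relation (idx d) ?a x \<and> support x \<noteq> {} \<and> support x \<subseteq> support v \<and>
      Gcd (x ` support x) = 1 \<and> ((\<forall>j\<in>support x. w j \<noteq> 0) \<longrightarrow> laurent_monomial w x = 1) \<and>
      ((\<exists>j. x j > 0 \<and> w j = 0) \<longleftrightarrow> (\<exists>j. x j < 0 \<and> w j = 0))"
    by (rule exI[of _ x]) (simp add: x J \<open>J \<noteq> {}\<close>)
  thus "\<exists>x. int_relation (idx d) ?a x \<and> support x \<noteq> {} \<and> support x \<subseteq> support v \<and>
      Gcd (x ` support x) = 1 \<and>
      ((\<forall>j\<in>support x. z j / of_real (sqrt (b j)) \<noteq> 0) \<longrightarrow>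
        laurent_monomial (\<lambda>j. z j / of_real (sqrt (b j))) x = 1) \<and>
      ((\<exists>j. x j > 0 \<and> z j / of_real (sqrt (b j)) = 0) \<longleftrightarrow>
        (\<exists>j. x j < 0 \<and> z j / of_real (sqrt (b j)) = 0))"
    unfolding w_def .
qed

lemma (in drury_arveson) vanishes_on_variety:
  assumes data: "weight_frequency_data d b n" and adm: "admissible d b n \<rho>"
    and g: "g \<in> H" and g0: "\<And>s. s \<in> half_plane \<rho> \<Longrightarrow> g (dirichlet_map d b n s) = 0"
    and z: "z \<in> uball" and q: "\<And>J. J \<in> minimal_dependent d n \<Longrightarrow> q_poly b n J z = 0"
  shows "g z = 0"
proof -
  define c where "c l = ip g (word_fun l)" for l
  \<comment> \<open>The added 1 keeps every sample point in the open half-plane; unit spacing makes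
    the step from \<open>\<sigma> 0\<close> to \<open>\<sigma> k\<close> a division by the
    \<open>k\<close>-th power of the value of the word.\<close>
  define \<sigma> where "\<sigma> k = complex_of_real (\<rho> + 1 + real k)" for k :: nat
  define f where "f k = dirichlet_map d b n (\<sigma> k)" for k
  define e where "e l = c l * word_prod (f 0) l" for l
  define L where "L = {l. set l \<subseteq> idx d}"
  define F where "F N = {l \<in> L. word_prod n l = N}" for N
  have n2: "\<And>j. j \<in> idx d \<Longrightarrow> n j \<ge> 2" and b0: "\<And>j. j \<in> idx d \<Longrightarrow> b j > 0"
    using data by (auto simp: weight_frequency_data_def)
  have \<sigma>: "\<sigma> k \<in> half_plane \<rho>" for k by (simp add: \<sigma>_def half_plane_def)
  have fb: "f k \<in> uball" for k
    unfolding f_def by (rule dirichlet_map_in_ball[OF data adm \<sigma>])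
  have N1: "word_prod n l \<ge> 1" if "l \<in> L" for l
    using that
  proof (induction l)
    case (Cons j l)
    hence "n j \<ge> 1" "word_prod n l \<ge> 1" using n2[of j] by (auto simp: L_def)
    thus ?case by simp
  qed simp
  have wL: "word_prod w l = 0" if "w \<in> uball" "l \<notin> L" for w l
  proof -
    obtain j where "j \<in> set l" "j \<notin> idx d" using \<open>l \<notin> L\<close> by (auto simp: L_def)
    thus ?thesis using Cd_ballD(1)[OF \<open>w \<in> uball\<close>] word_prod_eq_0 by metis
  qed
  have expand: "((\<lambda>l. c l * word_prod w l) has_sum g w) L" if w: "w \<in> uball" for w
  proof -
    have "((\<lambda>l. c l * word_prod w l) has_sum g w) UNIV \<longleftrightarrow>
        ((\<lambda>l. c l * word_prod w l) has_sum g w) L"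
      by (rule has_sum_cong_neutral) (auto simp: wL[OF w])
    thus ?thesis using word_expansion[OF g w] by (simp add: c_def)
  qed
  \<comment> \<open>A word is listed under its integer value, which is at least 1; the unordered sum
    over words becomes an iterated sum over values.\<close>
  have group: "((\<lambda>(N, l). h l) has_sum S) (Sigma {1..} F) \<longleftrightarrow> (h has_sum S) L"
    for h :: "nat list \<Rightarrow> complex" and S
    by (rule has_sum_reindex_bij_witness[of _ "\<lambda>l. (word_prod n l, l)" snd])
      (auto simp: F_def dest: N1)
  have fk: "word_prod (f k) l = word_prod (f 0) l / of_nat (word_prod n l) ^ k" if "l \<in> L" for k l
    using that
  proof (induction l)
    case (Cons j l)
    have j: "j \<in> idx d" using Cons.prems by (simp add: L_def)
    hence nj: "n j > 0" using n2[OF j] by simp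
    have "- \<sigma> k = - \<sigma> 0 - of_nat k" by (simp add: \<sigma>_def)
    hence "of_nat (n j) powr (- \<sigma> k) = of_nat (n j) powr (- \<sigma> 0) / of_nat (n j) ^ k"
      using nj by (simp add: powr_diff powr_nat)
    hence "f k j = f 0 j / of_nat (n j) ^ k" using j by (simp add: f_def dirichlet_map_def)
    thus ?case using Cons by (simp add: L_def power_mult_distrib)
  qed simp
  have ek: "((\<lambda>l. e l / of_nat (word_prod n l) ^ k) has_sum 0) L" for k
  proof -
    have "((\<lambda>l. c l * word_prod (f k) l) has_sum 0) L"
      using expand[OF fb, of k] g0[OF \<sigma>, of k] by (simp add: f_def)
    also have "?this \<longleftrightarrow> ?thesis"
      by (rule has_sum_cong) (simp add: fk[where k = k] e_def)
    finally show ?thesis .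
  qed
  define B where "B N = infsum e (F N)" for N
  have e_sum: "(e has_sum B N) (F N)" for N
  proof -
    have "e summable_on L" using has_sum_imp_summable[OF ek[of 0]] by simp
    hence "e summable_on F N" by (rule summable_on_subset_banach) (auto simp: F_def)
    thus ?thesis by (simp add: B_def)
  qed
  have "((\<lambda>N. B N / of_nat N ^ k) has_sum 0) {1..}" for k
  proof (rule has_sum_SigmaD)
    show "((\<lambda>(N, l). e l / of_nat (word_prod n l) ^ k) has_sum 0) (Sigma {1..} F)"
      using ek[of k] by (subst group)
    fix N :: nat
    have "((\<lambda>l. e l / of_nat N ^ k) has_sum B N / of_nat N ^ k) (F N)"
      by (intro has_sum_divide_const e_sum)
    also have "?this \<longleftrightarrow> ((\<lambda>l. e l / of_nat (word_prod n l) ^ k) has_sum B N / of_nat N ^ k) (F N)"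
      by (rule has_sum_cong) (simp add: F_def)
    finally show "((\<lambda>l. case (N, l) of (N, l) \<Rightarrow> e l / of_nat (word_prod n l) ^ k) has_sum
        B N / of_nat N ^ k) (F N)" by simp
  qed
  hence B0: "B N = 0" if "N \<ge> 1" for N using dirichlet_coeffs_eq_0 that by blast
  define w where "w = (\<lambda>j. z j / of_real (sqrt (b j)))"
  \<comment> \<open>The factor carrying the monomial at the base point \<open>f 0\<close> to the one
    at \<open>z\<close>. On words of value \<open>N\<close> the power of \<open>N\<close> is fixed,
    and so is the monomial in \<open>w\<close> by the vanishing of the \<open>q_J\<close>.\<close>
  define \<theta> where "\<theta> l = word_prod w l * of_nat (word_prod n l) powr \<sigma> 0" for l
  have z\<theta>: "word_prod z l = word_prod (f 0) l * \<theta> l" if "l \<in> L" for l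
    using that
  proof (induction l)
    case Nil
    show ?case by (simp add: \<theta>_def)
  next
    case (Cons j l)
    have j: "j \<in> idx d" and l: "l \<in> L" using Cons.prems by (auto simp: L_def)
    have nj: "n j > 0" "b j > 0" using n2[OF j] b0[OF j] by auto
    have "of_nat (n j * word_prod n l) powr \<sigma> 0 =
        of_nat (n j) powr \<sigma> 0 * (of_nat (word_prod n l) powr \<sigma> 0 :: complex)"
      unfolding of_nat_mult by (rule powr_times_real) auto
    hence "\<theta> (j # l) = w j * of_nat (n j) powr \<sigma> 0 * \<theta> l" by (simp add: \<theta>_def)
    moreover have "z j = f 0 j * (w j * of_nat (n j) powr \<sigma> 0)"
      using nj j by (simp add: f_def dirichlet_map_def w_def powr_minus)
    ultimately show ?case using Cons.IH[OF l] by simp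
  qed
  have \<theta>_const: "\<theta> l = \<theta> l'" if "l \<in> F N" "l' \<in> F N" for l l' N
    using that word_prod_eq_if_q_poly_zero[OF data z q, of l l']
    by (simp add: \<theta>_def F_def L_def w_def)
  have "((\<lambda>l. e l * \<theta> l) has_sum g z) L"
  proof -
    have "((\<lambda>l. c l * word_prod z l) has_sum g z) L" by (rule expand[OF z])
    also have "?this \<longleftrightarrow> ?thesis" by (rule has_sum_cong) (simp add: z\<theta> e_def)
    finally show ?thesis .
  qed
  hence "((\<lambda>(N, l). e l * \<theta> l) has_sum g z) (Sigma {1..} F)" by (subst group)
  hence "((\<lambda>N::nat. 0) has_sum g z) {1..}"
  proof (rule has_sum_SigmaD)
    fix N :: nat assume N: "N \<in> {1..}"
    \<comment> \<open>If no word has value \<open>N\<close>, this choice is arbitrary but harmless: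
      the sum over \<open>F N\<close> is empty and \<open>B N = 0\<close>.\<close>
    define l0 where "l0 = (SOME l. l \<in> F N)"
    have "((\<lambda>l. e l * \<theta> l0) has_sum B N * \<theta> l0) (F N)"
      by (intro has_sum_cmult_left e_sum)
    also have "?this \<longleftrightarrow> ((\<lambda>l. e l * \<theta> l) has_sum B N * \<theta> l0) (F N)"
    proof (rule has_sum_cong)
      fix l assume "l \<in> F N"
      moreover from this have "l0 \<in> F N" unfolding l0_def by (rule someI)
      ultimately show "e l * \<theta> l0 = e l * \<theta> l" using \<theta>_const by metis
    qed
    finally show "((\<lambda>l. case (N, l) of (N, l) \<Rightarrow> e l * \<theta> l) has_sum 0) (F N)"
      using B0 N by simp
  qed
  from infsumI[OF this] show ?thesis by simp
qed

theorem theoremA: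
  fixes d :: enat
    and b :: "nat \<Rightarrow> real"
    and n :: "nat \<Rightarrow> nat"
    and \<rho> :: real
    and H :: "((nat \<Rightarrow> complex) \<Rightarrow> complex) set"
    and ip :: "((nat \<Rightarrow> complex) \<Rightarrow> complex) \<Rightarrow> ((nat \<Rightarrow> complex) \<Rightarrow> complex) \<Rightarrow> complex"
  assumes "d \<ge> 2"
    and "weight_frequency_data d b n"
    and "log_dependent n (idx d)"
    and "admissible d b n \<rho>"
    and "is_drury_arveson_space d H ip"
  shows "multiplier_variety d H b n \<rho> =
    Cd_ball d \<inter> (\<Inter>J\<in>minimal_dependent d n. zero_set d (q_poly b n J))"
proof (intro equalityI subsetI)
  interpret rkhs "Cd_ball d" "drury_arveson_kernel d" H ip by (fact assms(5))
  interpret drury_arveson d H ip ..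
  fix z
  {
    assume "z \<in> multiplier_variety d H b n \<rho>"
    hence z: "z \<in> Cd_ball d" and van: "\<And>g. g \<in> multipliers \<Longrightarrow>
        (\<And>s. s \<in> half_plane \<rho> \<Longrightarrow> g (dirichlet_map d b n s) = 0) \<Longrightarrow> g z = 0"
      by (auto simp: multiplier_variety_def)
    have "q_poly b n J z = 0" if J: "J \<in> minimal_dependent d n" for J
    proof -
      have "on_ball (q_poly b n J) z = 0"
        by (rule van[OF q_poly_multiplier[OF assms(2) J]])
          (simp add: on_ball_def q_poly_dirichlet_map[OF assms(2) J])
      thus ?thesis using z by (simp add: on_ball_def)
    qed
    thus "z \<in> Cd_ball d \<inter> (\<Inter>J\<in>minimal_dependent d n. zero_set d (q_poly b n J))"
      using z by (auto simp: zero_set_def Cd_ball_def)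
  next
    assume "z \<in> Cd_ball d \<inter> (\<Inter>J\<in>minimal_dependent d n. zero_set d (q_poly b n J))"
    hence z: "z \<in> Cd_ball d" and q: "\<And>J. J \<in> minimal_dependent d n \<Longrightarrow> q_poly b n J z = 0"
      by (auto simp: zero_set_def)
    have "g z = 0" if "g \<in> multipliers" "\<forall>w\<in>dirichlet_map d b n ` half_plane \<rho>. g w = 0" for g
      using vanishes_on_variety[OF assms(2,4) multiplier_mem[OF that(1)] _ z q] that(2) by blast
    thus "z \<in> multiplier_variety d H b n \<rho>"
      using z by (auto simp: multiplier_variety_def)
  }
qed

end
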